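(* $\mathsf{AUC}_{[0,1]}<_W\mathsf{PCC}_{[0,1]}$.
   Context: A represented space is a pair $(X,\delta_X)$ with $\delta_X:\subseteq\mathbb{N}^\mathbb{N}\to X$ a partial surjection; $[0,1]$ carries its Cauchy representation. A realizer of $f:\subseteq X\rightrightarrows Y$ is a partial $F$ with $\delta_Y F(p)\in f(\delta_X(p))$ for all $p\in\mathrm{dom}(f\circ\delta_X)$. $f\le_W g$ if there are computable partial $H,K:\subseteq\mathbb{N}^\mathbb{N}\to\mathbb{N}^\mathbb{N}$ such that $p\mapsto H\langle p,GK(p)\rangle$ realizes $f$ for every realizer $G$ of $g$; $f<_W g$ means $f\le_W g$ and not $g\le_W f$. $\mathcal{A}_-([0,1])$ denotes the closed subsets of $[0,1]$ represented by negative information (a name of $A$ enumerates rational open intervals whose union is $[0,1]\setminus A$). $\mathsf C_{[0,1]}:\subseteq\mathcal A_-([0,1])\rightrightarrows[0,1]$, $A\mapsto A$, is defined on nonempty $A$. All-or-unique choice $\mathsf{AUC}_{[0,1]}$ is $\mathsf C_{[0,1]}$ restricted to the sets $[0,1]$ and $\{x\}$, $x\in[0,1]$. $\mathsf{PCC}_{[0,1]}$ is $\mathsf C_{[0,1]}$ restricted to intervals $[a,b]$ with $0\le a<b\le1$ (closed connected sets of positive measure). *)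

theory Defs
  imports "HOL-Analysis.Analysis" "HOL-Library.Nat_Bijection"
begin

datatype recf = RZ | RS | RProj nat | RComp recf "recf list" | RPrim recf recf | RMu recf

inductive reval :: "recf \<Rightarrow> nat list \<Rightarrow> nat \<Rightarrow> bool" where
  zero: "reval RZ xs 0"
| succ: "reval RS (x # xs) (Suc x)"
| proj: "i < length xs \<Longrightarrow> reval (RProj i) xs (xs ! i)"
| comp: "length ys = length gs \<Longrightarrow> (\<forall>i<length gs. reval (gs ! i) xs (ys ! i))
           \<Longrightarrow> reval f ys y \<Longrightarrow> reval (RComp f gs) xs y"
| prim0: "reval g xs y \<Longrightarrow> reval (RPrim g h) (0 # xs) y"
| primS: "reval (RPrim g h) (n # xs) r \<Longrightarrow> reval h (r # n # xs) y
           \<Longrightarrow> reval (RPrim g h) (Suc n # xs) y"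
| mu: "reval f (y # xs) 0 \<Longrightarrow> (\<forall>z<y. \<exists>v. reval f (z # xs) v \<and> v \<noteq> 0)
           \<Longrightarrow> reval (RMu f) xs y"

definition total_recursive :: "(nat \<Rightarrow> nat) \<Rightarrow> bool" where
  "total_recursive h \<longleftrightarrow> (\<exists>c. \<forall>n. reval c [n] (h n))"

type_synonym baire = "nat \<Rightarrow> nat"

definition prefix_code :: "baire \<Rightarrow> nat \<Rightarrow> nat" where
  "prefix_code p k = list_encode (map p [0..<k])"

text \<open>The partial function Baire to Baire computed by a (total recursive) word function h:
  on input p, output position n is determined once h (code of prefix p|k, n) is nonzero
  (the value being that number minus one), using the least such k. The output is defined
  iff every position is eventually determined. Every Type-2 computable partial function is
  the restriction of such a function, and each such function is Type-2 computable.\<close>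
definition type2_fun :: "(nat \<Rightarrow> nat) \<Rightarrow> baire \<Rightarrow> baire option" where
  "type2_fun h p =
     (if \<forall>n. \<exists>k. h (prod_encode (prefix_code p k, n)) \<noteq> 0
      then Some (\<lambda>n. h (prod_encode (prefix_code p
                  (LEAST k. h (prod_encode (prefix_code p k, n)) \<noteq> 0), n)) - 1)
      else None)"

definition computable_partial :: "(baire \<Rightarrow> baire option) \<Rightarrow> bool" where
  "computable_partial F \<longleftrightarrow> (\<exists>h. total_recursive h \<and> F = type2_fun h)"

definition bpair :: "baire \<Rightarrow> baire \<Rightarrow> baire" where
  "bpair p q = (\<lambda>n. if even n then p (n div 2) else q (n div 2))"

text \<open>A representation is a partial map from Baire space (None = outside the domain).
  A partial multi-valued function f from X to Y is a map to sets, its domain being the set of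
  points with nonempty value.\<close>

definition realizes ::
  "(baire \<Rightarrow> 'a option) \<Rightarrow> (baire \<Rightarrow> 'b option) \<Rightarrow> ('a \<Rightarrow> 'b set) \<Rightarrow> (baire \<Rightarrow> baire option) \<Rightarrow> bool"
where
  "realizes dX dY f F \<longleftrightarrow>
     (\<forall>p x. dX p = Some x \<and> f x \<noteq> {} \<longrightarrow>
        (\<exists>q y. F p = Some q \<and> dY q = Some y \<and> y \<in> f x))"

definition weihrauch_le ::
  "(baire \<Rightarrow> 'a option) \<Rightarrow> (baire \<Rightarrow> 'b option) \<Rightarrow> ('a \<Rightarrow> 'b set) \<Rightarrow>
   (baire \<Rightarrow> 'c option) \<Rightarrow> (baire \<Rightarrow> 'd option) \<Rightarrow> ('c \<Rightarrow> 'd set) \<Rightarrow> bool"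
where
  "weihrauch_le dX dY f dZ dW g \<longleftrightarrow>
     (\<exists>H K. computable_partial H \<and> computable_partial K \<and>
        (\<forall>G. realizes dZ dW g G \<longrightarrow>
           realizes dX dY f (\<lambda>p. Option.bind (K p) (\<lambda>r. Option.bind (G r) (\<lambda>s. H (bpair p s))))))"

definition weihrauch_less ::
  "(baire \<Rightarrow> 'a option) \<Rightarrow> (baire \<Rightarrow> 'b option) \<Rightarrow> ('a \<Rightarrow> 'b set) \<Rightarrow>
   (baire \<Rightarrow> 'c option) \<Rightarrow> (baire \<Rightarrow> 'd option) \<Rightarrow> ('c \<Rightarrow> 'd set) \<Rightarrow> bool"
where
  "weihrauch_less dX dY f dZ dW g \<longleftrightarrow>
     weihrauch_le dX dY f dZ dW g \<and> \<not> weihrauch_le dZ dW g dX dY f"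

definition nu_Q :: "nat \<Rightarrow> real" where
  "nu_Q n = (case prod_decode n of (a, b) \<Rightarrow> real_of_int (int_decode a) / real (Suc b))"

definition delta_unit :: "baire \<Rightarrow> real option" where
  "delta_unit p =
     (if \<exists>x. x \<in> {0..1} \<and> (\<forall>n. \<bar>nu_Q (p n) - x\<bar> \<le> (1/2) ^ n)
      then Some (THE x. x \<in> {0..1} \<and> (\<forall>n. \<bar>nu_Q (p n) - x\<bar> \<le> (1/2) ^ n))
      else None)"

text \<open>Rational open intervals: code k = <a,b> denotes (nu_Q a, nu_Q b) (empty if nu_Q a \<ge> nu_Q b,
  which allows enumerating no interval at all).\<close>
definition rat_interval :: "nat \<Rightarrow> real set" where
  "rat_interval k = (case prod_decode k of (a, b) \<Rightarrow> {nu_Q a <..< nu_Q b})"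

definition delta_neg :: "baire \<Rightarrow> real set option" where
  "delta_neg p = Some ({0..1} - (\<Union>n. rat_interval (p n)))"

definition AUC_unit :: "real set \<Rightarrow> real set" where
  "AUC_unit A = (if A = {0..1} \<or> (\<exists>x\<in>{0..1}. A = {x}) then A else {})"

definition PCC_unit :: "real set \<Rightarrow> real set" where
  "PCC_unit A = (if \<exists>a b. 0 \<le> a \<and> a < b \<and> b \<le> 1 \<and> A = {a..b} then A else {})"

end

(* AUC reduces to PCC: as long as nothing has been removed, K enumerates nothing and H copies the
   given point. Once a removal is noticed, at stage k, the set is known to be a singleton {x}; then x
   can be computed, K names a nondegenerate interval within 2^-(k+1) of x, and H, which has
   output fewer than k digits of a point of that interval, continues with the digits of x.

   For the converse it suffices to find one name p of an interval at which some realizer G of AUC makes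
   S = G o K continuous: then H turns it into a realizer of PCC continuous at p, which is impossible,
   since a later removal can avoid the approximation already given. If K maps some name p to a name
   of a singleton, G may compute its point there, hence is continuous. Otherwise K maps all names to
   names of [0,1], and G may always answer 0. *)

theory Submission
  imports Defs
begin

section \<open>Recursive functions of lists of fixed length\<close>

text \<open>Neither functional can revise an output position, so \<open>K\<close> and
  \<open>H\<close> must react to the same event although they read different inputs. That event is
  the first dirty stage \<open>k\<close>, which depends on \<open>p\<close> alone. Dirtiness is a
  decidable test on a finite grid; a removal may escape it for a while, but for a singleton
  compactness forces it to fire. The accuracy 2^-(k+1) protects the digits already copied: such a
  position n satisfies n+1 < k and holds digit n+1 of a name of some y, hence errs by at most
  2^-(n+1) against y, and y by at most 2^-(n+1) against x.

  The refutation uses \<open>H\<close> and \<open>K\<close> only through their continuity, so it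
  excludes continuous reductions as well. Its obstacle is that no realizer of AUC is continuous at a
  name of [0,1]; the case distinction keeps away from such names or, if \<open>K\<close> produces
  nothing else, replaces continuity of \<open>G\<close> by constancy of \<open>S\<close>. Continuity
  is taken relative to names of intervals because constancy is known only there.\<close>

definition rec_fn :: "nat \<Rightarrow> (nat list \<Rightarrow> nat) \<Rightarrow> bool" where
  "rec_fn k f \<longleftrightarrow> (\<exists>c. \<forall>xs. length xs = k \<longrightarrow> reval c xs (f xs))"

definition rec_test :: "nat \<Rightarrow> (nat list \<Rightarrow> bool) \<Rightarrow> bool" where
  "rec_test k P \<longleftrightarrow> rec_fn k (\<lambda>xs. of_bool (P xs))"

lemma rec_fn_comp:
  assumes g: "rec_fn (length fs) g" and fs: "\<And>f. f \<in> set fs \<Longrightarrow> rec_fn k f"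
  shows "rec_fn k (\<lambda>xs. g (map (\<lambda>f. f xs) fs))"
proof -
  obtain cg where cg: "\<And>xs. length xs = length fs \<Longrightarrow> reval cg xs (g xs)"
    using g unfolding rec_fn_def by blast
  have "\<forall>f\<in>set fs. \<exists>c. \<forall>xs. length xs = k \<longrightarrow> reval c xs (f xs)"
    using fs unfolding rec_fn_def by blast
  then obtain c where c: "\<And>f xs. f \<in> set fs \<Longrightarrow> length xs = k \<Longrightarrow> reval (c f) xs (f xs)"
    by metis
  have "reval (RComp cg (map c fs)) xs (g (map (\<lambda>f. f xs) fs))" if "length xs = k" for xs
    by (rule reval.comp[where ys = "map (\<lambda>f. f xs) fs"]) (use that c cg in auto)
  then show ?thesis unfolding rec_fn_def by blast
qed

lemma rec_fn_nth:
  assumes "i < k" shows "rec_fn k (\<lambda>xs. xs ! i)"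
  using assms unfolding rec_fn_def by (auto intro!: exI[of _ "RProj i"] reval.proj)

lemma rec_fn_cong:
  assumes "rec_fn k f" "\<And>xs. length xs = k \<Longrightarrow> f xs = g xs"
  shows "rec_fn k g"
  using assms unfolding rec_fn_def by metis

text \<open>Variables are written with \<open>hd\<close> and \<open>tl\<close> to fit the premises
  of \<open>rec_fn_rec_nat\<close>, where the accumulator and the counter stand in front of the old
  arguments.\<close>

lemma rec_fn_var:
  "rec_fn (Suc k) (\<lambda>xs. hd xs)"
  "rec_fn (Suc (Suc k)) (\<lambda>xs. hd (tl xs))"
  "rec_fn (Suc (Suc (Suc k))) (\<lambda>xs. hd (tl (tl xs)))"
  "rec_fn (Suc (Suc (Suc (Suc k)))) (\<lambda>xs. hd (tl (tl (tl xs))))"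
  "rec_fn (Suc (Suc (Suc (Suc (Suc k))))) (\<lambda>xs. hd (tl (tl (tl (tl xs)))))"
  "rec_fn (Suc (Suc (Suc (Suc (Suc (Suc k)))))) (\<lambda>xs. hd (tl (tl (tl (tl (tl xs))))))"
  by (rule rec_fn_cong[OF rec_fn_nth[of 0]] rec_fn_cong[OF rec_fn_nth[of 1]]
        rec_fn_cong[OF rec_fn_nth[of 2]] rec_fn_cong[OF rec_fn_nth[of 3]]
        rec_fn_cong[OF rec_fn_nth[of 4]] rec_fn_cong[OF rec_fn_nth[of 5]];
      auto simp: length_Suc_conv)+

text \<open>Many proofs below pass to variables by this rule or its variants before using a
  recursor: under the recursor an argument would appear as \<open>a (tl (tl xs))\<close>, where a
  hypothesis \<open>rec_fn k a\<close> does not apply directly.\<close>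

lemma rec_fn_comp1:
  assumes "rec_fn (Suc 0) (\<lambda>xs. f (hd xs))" "rec_fn k a"
  shows "rec_fn k (\<lambda>xs. f (a xs))"
  using rec_fn_comp[of "[a]" "\<lambda>xs. f (hd xs)" k] assms by simp

lemma rec_fn_comp2:
  assumes "rec_fn (Suc (Suc 0)) (\<lambda>xs. f (hd xs) (hd (tl xs)))" "rec_fn k a" "rec_fn k b"
  shows "rec_fn k (\<lambda>xs. f (a xs) (b xs))"
  using rec_fn_comp[of "[a, b]" "\<lambda>xs. f (hd xs) (hd (tl xs))" k] assms by auto

lemma rec_fn_comp3:
  assumes "rec_fn (Suc (Suc (Suc 0))) (\<lambda>xs. f (hd xs) (hd (tl xs)) (hd (tl (tl xs))))"
    "rec_fn k a" "rec_fn k b" "rec_fn k c"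
  shows "rec_fn k (\<lambda>xs. f (a xs) (b xs) (c xs))"
  using rec_fn_comp[of "[a, b, c]" "\<lambda>xs. f (hd xs) (hd (tl xs)) (hd (tl (tl xs)))" k] assms
  by auto

lemma rec_fn_Suc:
  assumes "rec_fn k a" shows "rec_fn k (\<lambda>xs. Suc (a xs))"
proof (rule rec_fn_comp1[OF _ assms])
  have "reval RS xs (Suc (hd xs))" if "length xs = Suc 0" for xs
    using that by (cases xs) (auto intro: reval.succ)
  then show "rec_fn (Suc 0) (\<lambda>xs. Suc (hd xs))" unfolding rec_fn_def by blast
qed

lemma rec_fn_const: "rec_fn k (\<lambda>xs. n)"
proof (induction n)
  case 0
  show ?case unfolding rec_fn_def by (auto intro!: exI[of _ RZ] reval.zero)
qed (rule rec_fn_Suc)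

lemma rec_fn_rec_nat:
  assumes b: "rec_fn k b" and s: "rec_fn (Suc (Suc k)) (\<lambda>xs. s (hd (tl xs)) (hd xs) (tl (tl xs)))"
    and n: "rec_fn k n"
  shows "rec_fn k (\<lambda>xs. rec_nat (b xs) (\<lambda>i r. s i r xs) (n xs))"
proof -
  obtain cb where cb: "\<And>xs. length xs = k \<Longrightarrow> reval cb xs (b xs)"
    using b unfolding rec_fn_def by blast
  obtain cs where cs: "\<And>r i xs. length xs = k \<Longrightarrow> reval cs (r # i # xs) (s i r xs)"
    using s unfolding rec_fn_def by (metis length_Cons list.sel(1) list.sel(3))
  define R where "R xs = rec_nat (b (tl xs)) (\<lambda>i r. s i r (tl xs)) (hd xs)" for xs
  have "reval (RPrim cb cs) (m # xs) (rec_nat (b xs) (\<lambda>i r. s i r xs) m)"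
    if "length xs = k" for m xs
    by (induction m) (use that cb cs in \<open>auto intro: reval.prim0 reval.primS\<close>)
  then have "rec_fn (Suc k) R"
    unfolding rec_fn_def R_def by (intro exI[of _ "RPrim cb cs"]) (auto simp: length_Suc_conv)
  then have "rec_fn k (\<lambda>xs. R (map (\<lambda>f. f xs) (n # map (\<lambda>i xs. xs ! i) [0..<k])))"
    by (intro rec_fn_comp) (auto simp: n rec_fn_nth)
  then show ?thesis
    by (rule rec_fn_cong) (auto simp: R_def o_def map_nth)
qed

lemma rec_fn_add:
  assumes "rec_fn k a" "rec_fn k b" shows "rec_fn k (\<lambda>xs. a xs + b xs)"
proof -
  have "rec_nat x (\<lambda>_ r. Suc r) y = x + y" for x y :: nat by (induction y) auto
  moreover have "rec_fn k (\<lambda>xs. rec_nat (a xs) (\<lambda>_ r. Suc r) (b xs))"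
    by (intro rec_fn_rec_nat rec_fn_Suc rec_fn_var assms)
  ultimately show ?thesis by simp
qed

lemma rec_fn_mult:
  assumes "rec_fn k a" "rec_fn k b" shows "rec_fn k (\<lambda>xs. a xs * b xs)"
proof (rule rec_fn_comp2[OF _ assms])
  have "rec_nat 0 (\<lambda>_ r. r + x) y = x * y" for x y :: nat by (induction y) auto
  moreover have "rec_fn (Suc (Suc 0)) (\<lambda>xs. rec_nat 0 (\<lambda>_ r. r + hd xs) (hd (tl xs)))"
    by (intro rec_fn_rec_nat rec_fn_add rec_fn_const rec_fn_var)
  ultimately show "rec_fn (Suc (Suc 0)) (\<lambda>xs. hd xs * hd (tl xs))" by simp
qed

lemma rec_fn_power2:
  assumes "rec_fn k a" shows "rec_fn k (\<lambda>xs. 2 ^ a xs)"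
proof -
  have "rec_nat 1 (\<lambda>_ r. r + r) y = (2::nat) ^ y" for y by (induction y) auto
  moreover have "rec_fn k (\<lambda>xs. rec_nat 1 (\<lambda>_ r. r + r) (a xs))"
    by (intro rec_fn_rec_nat rec_fn_add rec_fn_const rec_fn_var assms)
  ultimately show ?thesis by simp
qed

lemma rec_fn_diff:
  assumes "rec_fn k a" "rec_fn k b" shows "rec_fn k (\<lambda>xs. a xs - b xs)"
proof (rule rec_fn_comp2[OF _ assms])
  have pred: "rec_nat 0 (\<lambda>i _. i) y = y - Suc 0" for y :: nat by (cases y) auto
  have "rec_nat x (\<lambda>_ r. rec_nat 0 (\<lambda>i _. i) r) y = x - y" for x y :: nat
    by (induction y) (auto simp: pred)
  moreover have "rec_fn (Suc (Suc 0))
      (\<lambda>xs. rec_nat (hd xs) (\<lambda>_ r. rec_nat 0 (\<lambda>i _. i) r) (hd (tl xs)))"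
    by (intro rec_fn_rec_nat rec_fn_const rec_fn_var)
  ultimately show "rec_fn (Suc (Suc 0)) (\<lambda>xs. hd xs - hd (tl xs))" by simp
qed

lemma rec_fn_if:
  assumes "rec_test k P" "rec_fn k a" "rec_fn k b"
  shows "rec_fn k (\<lambda>xs. if P xs then a xs else b xs)"
proof -
  have "rec_fn k (\<lambda>xs. of_bool (P xs) * a xs + (1 - of_bool (P xs)) * b xs)"
    using assms unfolding rec_test_def
    by (intro rec_fn_add rec_fn_mult rec_fn_diff rec_fn_const)
  then show ?thesis by (rule rec_fn_cong) auto
qed

lemma rec_test_le:
  assumes "rec_fn k a" "rec_fn k b" shows "rec_test k (\<lambda>xs. a xs \<le> b xs)"
proof -
  have "rec_fn k (\<lambda>xs. 1 - (a xs - b xs))"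
    by (intro rec_fn_diff rec_fn_const assms)
  then show ?thesis unfolding rec_test_def by (rule rec_fn_cong) auto
qed

lemma rec_test_not:
  assumes "rec_test k P" shows "rec_test k (\<lambda>xs. \<not> P xs)"
proof -
  have "rec_fn k (\<lambda>xs. 1 - of_bool (P xs))"
    using assms unfolding rec_test_def by (intro rec_fn_diff rec_fn_const)
  then show ?thesis unfolding rec_test_def by (rule rec_fn_cong) auto
qed

lemma rec_test_conj:
  assumes "rec_test k P" "rec_test k Q" shows "rec_test k (\<lambda>xs. P xs \<and> Q xs)"
proof -
  have "rec_fn k (\<lambda>xs. of_bool (P xs) * of_bool (Q xs))"
    using assms unfolding rec_test_def by (rule rec_fn_mult)
  then show ?thesis unfolding rec_test_def by (rule rec_fn_cong) auto
qed

lemma rec_test_disj: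
  assumes "rec_test k P" "rec_test k Q" shows "rec_test k (\<lambda>xs. P xs \<or> Q xs)"
  using rec_test_not[OF rec_test_conj[OF rec_test_not[OF assms(1)] rec_test_not[OF assms(2)]]]
  by simp

lemma rec_test_less:
  assumes "rec_fn k a" "rec_fn k b" shows "rec_test k (\<lambda>xs. a xs < b xs)"
  using rec_test_not[OF rec_test_le[OF assms(2,1)]] by (simp add: not_le)

lemma rec_test_eq:
  assumes "rec_fn k a" "rec_fn k b" shows "rec_test k (\<lambda>xs. a xs = b xs)"
  using rec_test_conj[OF rec_test_le[OF assms] rec_test_le[OF assms(2,1)]] by (simp add: eq_iff)

lemma rec_fn_reindex:
  assumes "rec_fn m f" "length is = m" "\<And>i. i \<in> set is \<Longrightarrow> i < k"
  shows "rec_fn k (\<lambda>xs. f (map ((!) xs) is))"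
proof -
  have "rec_fn k (\<lambda>xs. f (map (\<lambda>h. h xs) (map (\<lambda>i xs. xs ! i) is)))"
    using assms by (intro rec_fn_comp) (auto intro: rec_fn_nth)
  then show ?thesis by (simp add: o_def)
qed

text \<open>For tests inside the step of a recursor: the first form drops the accumulator and tests
  the counter, as bounded quantifiers do; the second drops the counter and tests the accumulator, as
  \<open>bmin\<close> does.\<close>

lemma rec_test_skip:
  assumes "rec_test (Suc k) (\<lambda>xs. P (hd xs) (tl xs))"
  shows "rec_test (Suc (Suc k)) (\<lambda>xs. P (hd (tl xs)) (tl (tl xs)))"
    and "rec_test (Suc (Suc k)) (\<lambda>xs. P (hd xs) (tl (tl xs)))"
proof -
  have drop2: "map ((!) xs) [2..<Suc (Suc k)] = tl (tl xs)"
    if "length xs = Suc (Suc k)" for xs :: "nat list"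
    by (rule nth_equalityI) (use that in \<open>auto simp: nth_tl numeral_2_eq_2 simp del: upt_Suc\<close>)
  show "rec_test (Suc (Suc k)) (\<lambda>xs. P (hd (tl xs)) (tl (tl xs)))"
    unfolding rec_test_def
    by (rule rec_fn_cong[OF rec_fn_reindex[OF assms[unfolded rec_test_def], of "1 # [2..<Suc (Suc k)]"]])
      (auto simp: drop2 length_Suc_conv simp del: upt_Suc)
  show "rec_test (Suc (Suc k)) (\<lambda>xs. P (hd xs) (tl (tl xs)))"
    unfolding rec_test_def
    by (rule rec_fn_cong[OF rec_fn_reindex[OF assms[unfolded rec_test_def], of "0 # [2..<Suc (Suc k)]"]])
      (auto simp: drop2 length_Suc_conv simp del: upt_Suc)
qed

lemma rec_test_ex:
  assumes "rec_test (Suc k) (\<lambda>xs. P (hd xs) (tl xs))" "rec_fn k n"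
  shows "rec_test k (\<lambda>xs. \<exists>i<n xs. P i xs)"
proof -
  have "rec_fn k (\<lambda>xs. rec_nat 0 (\<lambda>i r. if P i xs then 1 else r) (n xs))"
    by (intro rec_fn_rec_nat rec_fn_if rec_fn_const rec_fn_var rec_test_skip assms)
  moreover have "rec_nat (0::nat) (\<lambda>i r. if P i xs then 1 else r) m = of_bool (\<exists>i<m. P i xs)" for m xs
    by (induction m) (auto simp: less_Suc_eq)
  ultimately show ?thesis unfolding rec_test_def by simp
qed

lemma rec_test_all:
  assumes "rec_test (Suc k) (\<lambda>xs. P (hd xs) (tl xs))" "rec_fn k n"
  shows "rec_test k (\<lambda>xs. \<forall>i<n xs. P i xs)"
  using rec_test_not[OF rec_test_ex[OF rec_test_not[OF assms(1)] assms(2)]] by simp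

text \<open>The value is \<^term>\<open>n\<close> if no number up to \<^term>\<open>n\<close>
  satisfies \<^term>\<open>P\<close>.\<close>

definition bmin :: "(nat \<Rightarrow> bool) \<Rightarrow> nat \<Rightarrow> nat" where
  "bmin P n = rec_nat 0 (\<lambda>i r. if P r then r else Suc i) n"

lemma bmin_le: "bmin P n \<le> n"
  and bmin_minimal: "j < bmin P n \<Longrightarrow> \<not> P j"
  and bmin_none: "\<not> P (bmin P n) \<Longrightarrow> bmin P n = n"
proof -
  have "bmin P n \<le> n \<and> (\<forall>j<bmin P n. \<not> P j) \<and> (P (bmin P n) \<or> bmin P n = n)"
    by (induction n) (auto simp: bmin_def less_Suc_eq)
  then show "bmin P n \<le> n" "j < bmin P n \<Longrightarrow> \<not> P j" "\<not> P (bmin P n) \<Longrightarrow> bmin P n = n"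
    by auto
qed

text \<open>The default value \<open>n\<close> is itself a candidate, so testing \<open>P\<close> at
  the result tells a successful search from a failed one.\<close>

lemma bmin_iff: "P (bmin P n) \<longleftrightarrow> (\<exists>i\<le>n. P i)"
  using bmin_le bmin_minimal bmin_none by (metis le_neq_implies_less)

lemma bmin_eqI:
  assumes "P m" "m \<le> n" "\<And>j. j < m \<Longrightarrow> \<not> P j" shows "bmin P n = m"
  by (metis assms bmin_iff bmin_minimal linorder_neqE_nat)

lemma bmin_cong:
  assumes "\<And>i. i \<le> n \<Longrightarrow> P i = Q i" shows "bmin P n = bmin Q n"
proof (cases "\<exists>i\<le>n. Q i")
  case True
  then have "Q (bmin Q n)" by (simp add: bmin_iff)
  then show ?thesis using assms bmin_le[of Q n] bmin_minimal[of _ Q n]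
    by (intro bmin_eqI) (auto dest: less_le_trans[THEN less_imp_le])
next
  case False
  then show ?thesis using assms bmin_none by (metis bmin_iff)
qed

lemma rec_fn_bmin:
  assumes "rec_test (Suc k) (\<lambda>xs. P (hd xs) (tl xs))" "rec_fn k n"
  shows "rec_fn k (\<lambda>xs. bmin (\<lambda>i. P i xs) (n xs))"
  unfolding bmin_def
  by (intro rec_fn_rec_nat rec_fn_if rec_fn_const rec_fn_Suc rec_fn_var rec_test_skip assms)

lemmas rec_fn_intros =
  rec_fn_const rec_fn_var rec_fn_Suc rec_fn_add rec_fn_mult rec_fn_diff rec_fn_power2 rec_fn_if
  rec_fn_bmin rec_test_not rec_test_conj rec_test_disj rec_test_le rec_test_less rec_test_eq
  rec_test_ex rec_test_all

section \<open>Codes of pairs, lists and rational intervals\<close>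

lemma rec_fn_prod_encode:
  assumes "rec_fn k a" "rec_fn k b" shows "rec_fn k (\<lambda>xs. prod_encode (a xs, b xs))"
proof -
  have tri: "rec_nat 0 (\<lambda>i r. r + Suc i) y = triangle y" for y by (induction y) auto
  have "rec_fn k (\<lambda>xs. rec_nat 0 (\<lambda>i r. r + Suc i) (a xs + b xs) + a xs)"
    by (intro rec_fn_rec_nat rec_fn_intros assms)
  then show ?thesis by (simp only: prod_encode_def tri split)
qed

text \<open>Both components of a pair are bounded by its code, so decoding is a bounded search
  through \<open>prod_encode\<close>.\<close>

lemma rec_fn_fst_prod_decode:
  assumes "rec_fn k a" shows "rec_fn k (\<lambda>xs. fst (prod_decode (a xs)))"
proof (rule rec_fn_comp1[OF _ assms])
  have "fst (prod_decode n) = bmin (\<lambda>x. \<exists>y<Suc n. prod_encode (x, y) = n) n" for n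
  proof -
    obtain x y where n: "n = prod_encode (x, y)" by (metis prod_decode_inverse surj_pair)
    show ?thesis
      by (rule bmin_eqI[symmetric])
        (auto simp: n le_prod_encode_1 less_Suc_eq_le le_prod_encode_2)
  qed
  moreover have "rec_fn (Suc 0)
      (\<lambda>xs. bmin (\<lambda>x. \<exists>y<Suc (hd xs). prod_encode (x, y) = hd xs) (hd xs))"
    by (intro rec_fn_prod_encode rec_fn_intros)
  ultimately show "rec_fn (Suc 0) (\<lambda>xs. fst (prod_decode (hd xs)))" by simp
qed

lemma rec_fn_snd_prod_decode:
  assumes "rec_fn k a" shows "rec_fn k (\<lambda>xs. snd (prod_decode (a xs)))"
proof (rule rec_fn_comp1[OF _ assms])
  have "snd (prod_decode n) = bmin (\<lambda>y. \<exists>x<Suc n. prod_encode (x, y) = n) n" for n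
  proof -
    obtain x y where n: "n = prod_encode (x, y)" by (metis prod_decode_inverse surj_pair)
    show ?thesis
      by (rule bmin_eqI[symmetric])
        (auto simp: n le_prod_encode_1 less_Suc_eq_le le_prod_encode_2)
  qed
  moreover have "rec_fn (Suc 0)
      (\<lambda>xs. bmin (\<lambda>y. \<exists>x<Suc (hd xs). prod_encode (x, y) = hd xs) (hd xs))"
    by (intro rec_fn_prod_encode rec_fn_intros)
  ultimately show "rec_fn (Suc 0) (\<lambda>xs. snd (prod_decode (hd xs)))" by simp
qed

lemma rec_test_even:
  assumes "rec_fn k a" shows "rec_test k (\<lambda>xs. even (a xs))"
proof -
  have "even n \<longleftrightarrow> (\<exists>m<Suc n. n = 2 * m)" for n :: nat by (auto simp: dvd_def)
  moreover have "rec_test k (\<lambda>xs. \<exists>m<Suc (a xs). a xs = 2 * m)"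
  proof -
    have "rec_test (Suc 0) (\<lambda>xs. \<exists>m<Suc (hd xs). hd xs = 2 * m)"
      by (intro rec_fn_intros)
    then show ?thesis using assms unfolding rec_test_def by (rule rec_fn_comp1)
  qed
  ultimately show ?thesis by simp
qed

text \<open>\<open>list_encode\<close> sends the empty list to \<open>0\<close> and
  \<open>x # xs\<close> to \<open>Suc (prod_encode (x, list_encode xs))\<close>; hence one step
  subtracts one and takes the second component.\<close>

definition code_drop :: "nat \<Rightarrow> nat \<Rightarrow> nat" where
  "code_drop j w = rec_nat w (\<lambda>_ r. snd (prod_decode (r - 1))) j"

definition code_nth :: "nat \<Rightarrow> nat \<Rightarrow> nat" where
  "code_nth w j = fst (prod_decode (code_drop j w - 1))"

definition code_length :: "nat \<Rightarrow> nat" where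
  "code_length w = bmin (\<lambda>j. code_drop j w = 0) w"

lemma code_drop_list_encode:
  "j \<le> length xs \<Longrightarrow> code_drop j (list_encode xs) = list_encode (drop j xs)"
proof (induction j)
  case (Suc j)
  then have "drop j xs = xs ! j # drop (Suc j) xs" by (simp add: Cons_nth_drop_Suc)
  with Suc show ?case by (simp add: code_drop_def)
qed (simp add: code_drop_def)

lemma code_nth_list_encode: "j < length xs \<Longrightarrow> code_nth (list_encode xs) j = xs ! j"
  by (simp add: code_nth_def code_drop_list_encode flip: Cons_nth_drop_Suc)

lemma length_le_list_encode: "length xs \<le> list_encode xs"
  by (induction xs) (auto intro: order_trans[OF _ le_prod_encode_2])

lemma code_length_list_encode: "code_length (list_encode xs) = length xs"
  unfolding code_length_def
proof (rule bmin_eqI)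
  fix j assume "j < length xs"
  then show "code_drop j (list_encode xs) \<noteq> 0"
    by (simp add: code_drop_list_encode flip: Cons_nth_drop_Suc)
qed (simp_all add: code_drop_list_encode length_le_list_encode)

lemma code_nth_prefix_code: "j < l \<Longrightarrow> code_nth (prefix_code p l) j = p j"
  by (simp add: prefix_code_def code_nth_list_encode)

lemma code_length_prefix_code: "code_length (prefix_code p l) = l"
  by (simp add: prefix_code_def code_length_list_encode)

lemma rec_fn_code_drop:
  assumes "rec_fn k j" "rec_fn k w" shows "rec_fn k (\<lambda>xs. code_drop (j xs) (w xs))"
  unfolding code_drop_def
  by (intro rec_fn_rec_nat rec_fn_intros rec_fn_snd_prod_decode assms)

lemma rec_fn_code_nth:
  assumes "rec_fn k j" "rec_fn k w" shows "rec_fn k (\<lambda>xs. code_nth (w xs) (j xs))"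
  unfolding code_nth_def
  by (intro rec_fn_intros rec_fn_code_drop rec_fn_fst_prod_decode assms)

lemma rec_fn_code_length:
  assumes "rec_fn k w" shows "rec_fn k (\<lambda>xs. code_length (w xs))"
proof (rule rec_fn_comp1[OF _ assms])
  show "rec_fn (Suc 0) (\<lambda>xs. code_length (hd xs))"
    unfolding code_length_def by (intro rec_fn_intros rec_fn_code_drop)
qed

lemma total_recursive_rec_fn:
  assumes "rec_fn (Suc (Suc 0)) (\<lambda>xs. f (hd xs) (hd (tl xs)))"
  shows "total_recursive (\<lambda>c. f (fst (prod_decode c)) (snd (prod_decode c)))"
proof -
  have "rec_fn (Suc 0) (\<lambda>xs. f (fst (prod_decode (hd xs))) (snd (prod_decode (hd xs))))"
    by (intro rec_fn_comp2[OF assms] rec_fn_fst_prod_decode rec_fn_snd_prod_decode rec_fn_var)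
  then show ?thesis
    unfolding rec_fn_def total_recursive_def by (metis length_Cons list.sel(1) list.size(3))
qed

section \<open>Deciding whether a grid cell lies in a rational interval\<close>

text \<open>Intervals being convex, the two endpoints decide whether the whole closed cell is
  contained.\<close>

definition cell_in :: "nat \<Rightarrow> nat \<Rightarrow> nat \<Rightarrow> bool" where
  "cell_in c t i \<longleftrightarrow> 0 < t \<and> real i / real t \<in> rat_interval c \<and> real (Suc i) / real t \<in> rat_interval c"

text \<open>An even integer code \<open>a\<close> stands for \<open>a div 2\<close>, an odd one for
  a negative number, which lies below every grid point. The factor 2 on the right compensates for
  the halving; cross-multiplication leaves arithmetic of natural numbers only.\<close>

lemma nu_Q_less_iff:
  assumes "0 < t"
  shows "nu_Q c < real i / real t \<longleftrightarrow>
    \<not> even (fst (prod_decode c)) \<or> fst (prod_decode c) * t < 2 * i * Suc (snd (prod_decode c))"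
proof -
  obtain a b where c: "prod_decode c = (a, b)" by (cases "prod_decode c")
  show ?thesis
  proof (cases "even a")
    case True
    then obtain m where a: "a = 2 * m" by (auto elim: evenE)
    have "nu_Q c < real i / real t \<longleftrightarrow> real (m * t) < real (i * Suc b)"
      using assms by (simp add: nu_Q_def c int_decode_def sum_decode_def a field_simps)
    also have "\<dots> \<longleftrightarrow> 2 * (m * t) < 2 * (i * Suc b)" by (simp only: of_nat_less_iff nat_mult_less_cancel_disj) simp
    finally show ?thesis using True by (simp only: c a fst_conv snd_conv mult.assoc simp_thms)
  next
    case False
    then have "nu_Q c < 0"
      by (simp add: nu_Q_def c int_decode_def sum_decode_def divide_less_0_iff)
    also have "0 \<le> real i / real t" by simp
    finally show ?thesis using False by (simp add: c)
  qed
qed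

lemma less_nu_Q_iff:
  assumes "0 < t"
  shows "real i / real t < nu_Q c \<longleftrightarrow>
    even (fst (prod_decode c)) \<and> 2 * i * Suc (snd (prod_decode c)) < fst (prod_decode c) * t"
proof -
  obtain a b where c: "prod_decode c = (a, b)" by (cases "prod_decode c")
  show ?thesis
  proof (cases "even a")
    case True
    then obtain m where a: "a = 2 * m" by (auto elim: evenE)
    have "real i / real t < nu_Q c \<longleftrightarrow> real (i * Suc b) < real (m * t)"
      using assms by (simp add: nu_Q_def c int_decode_def sum_decode_def a field_simps)
    also have "\<dots> \<longleftrightarrow> 2 * (i * Suc b) < 2 * (m * t)" by (simp only: of_nat_less_iff nat_mult_less_cancel_disj) simp
    finally show ?thesis using True by (simp only: c a fst_conv snd_conv mult.assoc simp_thms)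
  next
    case False
    then have "nu_Q c < 0"
      by (simp add: nu_Q_def c int_decode_def sum_decode_def divide_less_0_iff)
    also have "0 \<le> real i / real t" by simp
    finally show ?thesis using False by (simp add: c)
  qed
qed

lemma rec_test_cell_in:
  assumes "rec_fn k c" "rec_fn k t" "rec_fn k i"
  shows "rec_test k (\<lambda>xs. cell_in (c xs) (t xs) (i xs))"
proof -
  let ?a = "\<lambda>c. fst (prod_decode (fst (prod_decode c)))"
  let ?a' = "\<lambda>c. snd (prod_decode (fst (prod_decode c)))"
  let ?b = "\<lambda>c. fst (prod_decode (snd (prod_decode c)))"
  let ?b' = "\<lambda>c. snd (prod_decode (snd (prod_decode c)))"
  have between: "real i / real t \<in> rat_interval c \<longleftrightarrow>
      (\<not> even (?a c) \<or> ?a c * t < 2 * i * Suc (?a' c)) \<and> even (?b c) \<and>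
      2 * i * Suc (?b' c) < ?b c * t" if "0 < t" for c t i
    using nu_Q_less_iff[OF that] less_nu_Q_iff[OF that]
    by (auto simp: rat_interval_def split_beta)
  have "rec_test k (\<lambda>xs. 0 < t xs \<and>
      ((\<not> even (?a (c xs)) \<or> ?a (c xs) * t xs < 2 * i xs * Suc (?a' (c xs))) \<and> even (?b (c xs)) \<and>
        2 * i xs * Suc (?b' (c xs)) < ?b (c xs) * t xs) \<and>
      ((\<not> even (?a (c xs)) \<or> ?a (c xs) * t xs < 2 * Suc (i xs) * Suc (?a' (c xs))) \<and> even (?b (c xs)) \<and>
        2 * Suc (i xs) * Suc (?b' (c xs)) < ?b (c xs) * t xs))"
    by (intro rec_fn_intros rec_test_even rec_fn_fst_prod_decode rec_fn_snd_prod_decode assms)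
  then show ?thesis
    unfolding cell_in_def using between by (simp cong: conj_cong del: of_nat_Suc)
qed

section \<open>Locating the point of a singleton\<close>

text \<open>At stage \<^term>\<open>t\<close> the unit interval is cut into \<^term>\<open>t\<close> cells, and only cells that lie in a single
  one of the first \<^term>\<open>t\<close> enumerated intervals count as removed. This is decidable, and by compactness
  no removed cell away from the remaining point is missed in the long run.\<close>

definition covered :: "baire \<Rightarrow> nat \<Rightarrow> nat \<Rightarrow> bool" where
  "covered p t i \<longleftrightarrow> (\<exists>j<t. cell_in (p j) t i)"

definition dirty :: "baire \<Rightarrow> nat \<Rightarrow> bool" where
  "dirty p t \<longleftrightarrow> (\<exists>i<t. covered p t i)"

text \<open>The last two inequalities say |i/t - m/t| \<le> 2^-n, cross-multiplied and arranged
  without subtraction, which would be truncated. \<open>2 ^ n \<le> t\<close> makes cells no wider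
  than 2^-n.\<close>

definition locates :: "baire \<Rightarrow> nat \<Rightarrow> nat \<Rightarrow> nat \<Rightarrow> bool" where
  "locates p t n m \<longleftrightarrow> 2 ^ n \<le> t \<and> m < t \<and>
     (\<forall>i<t. covered p t i \<or> (i * 2 ^ n \<le> t + m * 2 ^ n \<and> m * 2 ^ n \<le> t + i * 2 ^ n))"

text \<open>A stage after a dirty one may be clean again, because the grid changes with
  \<open>t\<close>. The least dirty stage stays fixed once it has been reached.\<close>

definition first_dirty :: "baire \<Rightarrow> nat \<Rightarrow> nat" where
  "first_dirty p t = bmin (dirty p) t"

definition location :: "baire \<Rightarrow> nat \<Rightarrow> nat \<Rightarrow> nat" where
  "location p t n = bmin (locates p t n) t"

lemma prefix_cong:
  assumes "\<And>j. j < t \<Longrightarrow> p j = q j"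
  shows "i \<le> t \<Longrightarrow> dirty p i = dirty q i" "locates p t n = locates q t n"
    "first_dirty p t = first_dirty q t" "location p t n = location q t n"
proof -
  have cov: "covered p i m = covered q i m" if "i \<le> t" for i m
    using assms that by (auto simp: covered_def)
  show d: "dirty p i = dirty q i" if "i \<le> t" for i
    using cov that by (simp add: dirty_def)
  show loc: "locates p t n = locates q t n"
    using cov[OF order_refl] by (simp add: locates_def fun_eq_iff)
  show "first_dirty p t = first_dirty q t"
    unfolding first_dirty_def by (rule bmin_cong) (rule d)
  show "location p t n = location q t n"
    by (simp add: location_def loc)
qed

text \<open>The factor \<open>c\<close> serves both functionals: it is 1 when the coded prefix is
  one of \<open>p\<close>, and 2 when it is one of a pair, where \<open>p\<close> occupies the even
  positions.\<close>

lemma rec_test_covered: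
  assumes "rec_fn k c" "rec_fn k w" "rec_fn k t" "rec_fn k i"
  shows "rec_test k (\<lambda>xs. covered (\<lambda>j. code_nth (w xs) (c xs * j)) (t xs) (i xs))"
proof -
  have "rec_test (Suc (Suc (Suc (Suc 0)))) (\<lambda>xs. covered (\<lambda>j. code_nth (hd (tl xs)) (hd xs * j))
      (hd (tl (tl xs))) (hd (tl (tl (tl xs)))))"
    unfolding covered_def by (intro rec_fn_intros rec_test_cell_in rec_fn_code_nth)
  from rec_fn_comp[of "[c, w, t, i]", OF _ , simplified, OF this[unfolded rec_test_def]] assms
  show ?thesis unfolding rec_test_def by auto
qed

lemma rec_test_dirty:
  assumes "rec_fn k c" "rec_fn k w" "rec_fn k t"
  shows "rec_test k (\<lambda>xs. dirty (\<lambda>j. code_nth (w xs) (c xs * j)) (t xs))"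
proof -
  have "rec_test (Suc (Suc (Suc 0)))
      (\<lambda>xs. dirty (\<lambda>j. code_nth (hd (tl xs)) (hd xs * j)) (hd (tl (tl xs))))"
    unfolding dirty_def by (intro rec_fn_intros rec_test_covered)
  then show ?thesis unfolding rec_test_def
    by (rule rec_fn_comp3[where f = "\<lambda>c w t. of_bool (dirty (\<lambda>j. code_nth w (c * j)) t)"]) fact+
qed

lemma rec_test_locates:
  assumes "rec_fn k c" "rec_fn k w" "rec_fn k t" "rec_fn k n" "rec_fn k m"
  shows "rec_test k (\<lambda>xs. locates (\<lambda>j. code_nth (w xs) (c xs * j)) (t xs) (n xs) (m xs))"
proof -
  have "rec_test (Suc (Suc (Suc (Suc (Suc 0)))))
      (\<lambda>xs. locates (\<lambda>j. code_nth (hd (tl xs)) (hd xs * j)) (hd (tl (tl xs)))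
        (hd (tl (tl (tl xs)))) (hd (tl (tl (tl (tl xs))))))"
    unfolding locates_def by (intro rec_fn_intros rec_test_covered)
  from rec_fn_comp[of "[c, w, t, n, m]", OF _ , simplified, OF this[unfolded rec_test_def]] assms
  show ?thesis unfolding rec_test_def by auto
qed

lemma rec_fn_first_dirty:
  assumes "rec_fn k c" "rec_fn k w" "rec_fn k t"
  shows "rec_fn k (\<lambda>xs. first_dirty (\<lambda>j. code_nth (w xs) (c xs * j)) (t xs))"
proof (rule rec_fn_comp3[OF _ assms])
  show "rec_fn (Suc (Suc (Suc 0)))
      (\<lambda>xs. first_dirty (\<lambda>j. code_nth (hd (tl xs)) (hd xs * j)) (hd (tl (tl xs))))"
    unfolding first_dirty_def
    by (intro rec_fn_bmin[where P = "\<lambda>i xs. dirty (\<lambda>j. code_nth (hd (tl xs)) (hd xs * j)) i"]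
        rec_fn_intros rec_test_dirty)
qed

lemma rec_fn_location:
  assumes "rec_fn k c" "rec_fn k w" "rec_fn k t" "rec_fn k n"
  shows "rec_fn k (\<lambda>xs. location (\<lambda>j. code_nth (w xs) (c xs * j)) (t xs) (n xs))"
proof -
  have "rec_fn (Suc (Suc (Suc (Suc 0))))
      (\<lambda>xs. location (\<lambda>j. code_nth (hd (tl xs)) (hd xs * j)) (hd (tl (tl xs))) (hd (tl (tl (tl xs)))))"
    unfolding location_def
    by (intro rec_fn_bmin[where P = "\<lambda>i xs. locates (\<lambda>j. code_nth (hd (tl xs)) (hd xs * j))
          (hd (tl (tl xs))) (hd (tl (tl (tl xs)))) i"]
        rec_fn_intros rec_test_locates)
  from rec_fn_comp[of "[c, w, t, n]", OF _ , simplified, OF this] assms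
  show ?thesis by auto
qed

section \<open>Correctness of the stage tests\<close>

lemma cell_in_subset:
  assumes "cell_in c t i" shows "{real i / real t .. real (Suc i) / real t} \<subseteq> rat_interval c"
  using assms by (auto simp: cell_in_def rat_interval_def split: prod.splits)

lemma open_rat_interval: "open (rat_interval c)"
  by (simp add: rat_interval_def split: prod.splits)

lemma unit_in_cell:
  fixes x :: real
  assumes "x \<in> {0..1}" "0 < t"
  obtains i where "i < t" "x \<in> {real i / real t .. real (Suc i) / real t}"
proof (cases "x = 1")
  \<comment> \<open>The floor of \<open>x * t\<close> would give the index \<open>t\<close> here, so
    the last cell takes its right endpoint.\<close>
  case True
  show ?thesis
    by (rule that[of "t - 1"]) (use True assms in \<open>auto simp: divide_simps\<close>)
next
  case False
  define i where "i = nat \<lfloor>x * real t\<rfloor>"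
  have "0 \<le> x * real t" using assms by simp
  then have i: "real i \<le> x * real t" "x * real t < real i + 1"
    unfolding i_def by (linarith, linarith)
  have "x * real t < 1 * real t" using False assms by (intro mult_strict_right_mono) auto
  with i have "real i < real t" by linarith
  then show ?thesis
    by (intro that[of i]) (use i assms in \<open>auto simp: field_simps\<close>)
qed

lemma dirty_imp_ne_unit:
  assumes "dirty p t" shows "{0..1} - (\<Union>n. rat_interval (p n)) \<noteq> {0..1::real}"
proof -
  obtain i j where "i < t" "cell_in (p j) t i"
    using assms by (auto simp: dirty_def covered_def)
  then have "real i / real t \<in> rat_interval (p j)" "real i / real t \<in> {0..1}"
    by (auto simp: cell_in_def)
  then show ?thesis by blast
qed

text \<open>A point that is never removed lies in a cell that is not covered. The left end of that
  cell is within 2^-n of m/t, and the cell width adds at most another 2^-n.\<close>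

lemma locates_imp_near:
  assumes "locates p t n m" "x \<in> {0..1} - (\<Union>n. rat_interval (p n))"
  shows "\<bar>real m / real t - x\<bar> \<le> 2 / 2 ^ n"
proof -
  have t: "2 ^ n \<le> t" "0 < t" using assms(1) by (auto simp: locates_def)
  obtain i where i: "i < t" "x \<in> {real i / real t .. real (Suc i) / real t}"
    using unit_in_cell[of x t] assms(2) t by auto
  have "\<not> covered p t i"
    using assms(2) i cell_in_subset unfolding covered_def by blast
  then have "i * 2 ^ n \<le> t + m * 2 ^ n" "m * 2 ^ n \<le> t + i * 2 ^ n"
    using assms(1) i by (auto simp: locates_def)
  then have "real (i * 2 ^ n) \<le> real (t + m * 2 ^ n)" "real (m * 2 ^ n) \<le> real (t + i * 2 ^ n)"
    by (simp_all only: of_nat_le_iff)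
  then have "real i / real t \<le> 1 / 2 ^ n + real m / real t" "real m / real t \<le> 1 / 2 ^ n + real i / real t"
    using t by (simp_all add: field_simps)
  moreover have "real (Suc i) / real t = real i / real t + 1 / real t" by (simp add: add_divide_distrib)
  moreover have "1 / real t \<le> 1 / 2 ^ n"
  proof -
    have "(2::real) ^ n \<le> real t" using t(1) by (metis of_nat_le_iff of_nat_numeral of_nat_power)
    then show ?thesis by (intro divide_left_mono) (use t in auto)
  qed
  moreover have "2 / 2 ^ n = 1 / 2 ^ n + (1 / 2 ^ n :: real)" by simp
  ultimately show ?thesis using i(2) unfolding atLeastAtMost_iff by linarith
qed

text \<open>Away from \<open>x\<close> the interval is compact and covered by finitely many removed
  intervals. A fine enough grid puts each cell starting there inside one of them, so only cells near
  \<open>x\<close> survive, and the cell containing \<open>x\<close> serves as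
  \<open>m\<close>.\<close>

lemma locates_eventually:
  assumes x: "{0..1} - (\<Union>n. rat_interval (p n)) = {x}"
  obtains t\<^sub>0 where "\<And>t. t\<^sub>0 \<le> t \<Longrightarrow> \<exists>m. locates p t n m"
proof -
  define e :: real where "e = 1 / 2 ^ Suc n"
  have e: "0 < e" "2 * e = 1 / 2 ^ n" by (simp_all add: e_def)
  define C where "C = {0..1} - ball x e"
  have "compact C" unfolding C_def by (intro compact_diff) auto
  moreover have "C \<subseteq> (\<Union>j\<in>UNIV. rat_interval (p j))"
  proof
    fix y assume "y \<in> C"
    then have "y \<in> {0..1}" "y \<noteq> x" using e(1) by (auto simp: C_def)
    then show "y \<in> (\<Union>j\<in>UNIV. rat_interval (p j))" using x by blast
  qed
  ultimately obtain J where J: "finite J" "C \<subseteq> (\<Union>j\<in>J. rat_interval (p j))"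
    using compactE_image[of C UNIV "\<lambda>j. rat_interval (p j)"] open_rat_interval by metis
  \<comment> \<open>\<open>d\<close> is a Lebesgue number of the finite cover; a cell narrower than
    \<open>d\<close> with its left end in \<open>C\<close> fits into a single interval.\<close>
  obtain d where d: "0 < d" "\<And>y. y \<in> C \<Longrightarrow> \<exists>j\<in>J. ball y d \<subseteq> rat_interval (p j)"
    using Heine_Borel_lemma[OF \<open>compact C\<close> J(2)] open_rat_interval by auto
  obtain s where s: "2 / d < real s" using reals_Archimedean2 by blast
  obtain j\<^sub>0 where j\<^sub>0: "\<And>j. j \<in> J \<Longrightarrow> j < j\<^sub>0"
    using J(1) finite_nat_set_iff_bounded by auto
  show ?thesis
  proof (rule that[of "max j\<^sub>0 (max s (2 ^ Suc n))"])
    fix t assume "max j\<^sub>0 (max s (2 ^ Suc n)) \<le> t"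
    then have t: "j\<^sub>0 \<le> t" "s \<le> t" "2 ^ Suc n \<le> t" by auto
    have t0: "0 < t" using t(3) by (rule less_le_trans[rotated]) simp
    have "real (2 ^ Suc n) \<le> real t" using t(3) by (simp only: of_nat_le_iff)
    then have te: "1 / real t \<le> e"
      using t0 unfolding e_def by (intro divide_left_mono) auto
    have td: "1 / real t < d"
    proof -
      have "2 / d < real t" using s t(2) by linarith
      then have "2 < real t * d" using d(1) by (simp add: field_simps)
      then show ?thesis using t0 by (simp add: field_simps)
    qed
    have "x \<in> {0..1}" using x by auto
    then obtain m where m: "m < t" "x \<in> {real m / real t .. real (Suc m) / real t}"
      using unit_in_cell t0 by blast
    then have xm: "\<bar>real m / real t - x\<bar> \<le> e"
      using te by (simp add: add_divide_distrib)
    have "covered p t i \<or> (i * 2 ^ n \<le> t + m * 2 ^ n \<and> m * 2 ^ n \<le> t + i * 2 ^ n)"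
      if i: "i < t" for i
    proof (cases "real i / real t \<in> C")
      case True
      then obtain j where j: "j \<in> J" "ball (real i / real t) d \<subseteq> rat_interval (p j)"
        using d(2) by blast
      have "real i / real t \<in> ball (real i / real t) d" "real (Suc i) / real t \<in> ball (real i / real t) d"
        using d(1) td by (simp_all add: dist_real_def add_divide_distrib)
      then have "cell_in (p j) t i" using j(2) t0 unfolding cell_in_def by blast
      then show ?thesis using j\<^sub>0[OF j(1)] t(1) unfolding covered_def by auto
    next
      case False
      then have "\<bar>x - real i / real t\<bar> < e"
        using i by (auto simp: C_def dist_real_def)
      with xm e(2) have "real i / real t \<le> 1 / 2 ^ n + real m / real t"
        "real m / real t \<le> 1 / 2 ^ n + real i / real t" by linarith+
      then have "real (i * 2 ^ n) \<le> real (t + m * 2 ^ n)" "real (m * 2 ^ n) \<le> real (t + i * 2 ^ n)"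
        using t0 by (simp_all add: field_simps)
      then show ?thesis by (simp only: of_nat_le_iff simp_thms)
    qed
    then show "\<exists>m. locates p t n m"
      using m(1) t(3) unfolding locates_def by (intro exI[of _ m]) auto
  qed
qed

text \<open>Were nothing ever covered, locating with precision 1/8 would place every cell near one
  \<open>m\<close>, yet the first and the last cell are too far apart for that.\<close>

lemma dirty_if_singleton:
  assumes "{0..1} - (\<Union>n. rat_interval (p n)) = {x}"
  shows "\<exists>t. dirty p t"
proof (rule ccontr)
  assume clean: "\<nexists>t. dirty p t"
  obtain t m where "locates p t 3 m" using locates_eventually[OF assms] by blast
  then have t: "8 \<le> t" "m < t"
    and near: "\<And>i. i < t \<Longrightarrow> i * 8 \<le> t + m * 8 \<and> m * 8 \<le> t + i * 8"
    using clean by (auto simp: locates_def dirty_def)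
  show False using near[of 0] near[of "t - 1"] t by auto
qed

lemma first_dirty_eq:
  assumes "dirty p k" "\<And>j. j < k \<Longrightarrow> \<not> dirty p j"
  shows "dirty p (first_dirty p t) \<longleftrightarrow> k \<le> t" "k \<le> t \<Longrightarrow> first_dirty p t = k"
proof -
  show "dirty p (first_dirty p t) \<longleftrightarrow> k \<le> t"
    unfolding first_dirty_def bmin_iff by (meson assms le_trans not_le)
  show "k \<le> t \<Longrightarrow> first_dirty p t = k"
    unfolding first_dirty_def by (rule bmin_eqI) (use assms in auto)
qed

lemma locates_location: "locates p t n (location p t n) \<longleftrightarrow> (\<exists>m. locates p t n m)"
proof
  assume "\<exists>m. locates p t n m"
  then have "\<exists>m\<le>t. locates p t n m" unfolding locates_def by (meson less_imp_le)
  then show "locates p t n (location p t n)" unfolding location_def by (simp add: bmin_iff)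
qed blast

section \<open>The reduction of AUC to PCC\<close>

text \<open>The value \<^term>\<open>g p l n\<close> means \<open>undecided\<close> if it is \<open>0\<close>, and otherwise
  exceeds the output by one.\<close>

definition stagewise :: "(baire \<Rightarrow> nat \<Rightarrow> nat \<Rightarrow> nat) \<Rightarrow> baire \<Rightarrow> baire option" where
  "stagewise g p = (if \<forall>n. \<exists>l. g p l n \<noteq> 0
     then Some (\<lambda>n. g p (LEAST l. g p l n \<noteq> 0) n - 1) else None)"

lemma type2_fun_eq_stagewise:
  "type2_fun h = stagewise (\<lambda>p l n. h (prod_encode (prefix_code p l, n)))"
  by (simp add: fun_eq_iff type2_fun_def stagewise_def)

text \<open>Lets a functional be written on sequences: \<open>f\<close> is its version on codes of
  prefixes, and the second premise forces stage \<open>l\<close> to read only the first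
  \<open>l\<close> entries.\<close>

lemma computable_partial_stagewise:
  assumes "rec_fn (Suc (Suc 0)) (\<lambda>xs. f (hd xs) (hd (tl xs)))"
    and "\<And>p l n. f (prefix_code p l) n = g p l n"
  shows "computable_partial (stagewise g)"
proof -
  have "stagewise g = type2_fun (\<lambda>c. f (fst (prod_decode c)) (snd (prod_decode c)))"
    unfolding type2_fun_eq_stagewise by (simp add: assms(2))
  then show ?thesis
    unfolding computable_partial_def using total_recursive_rec_fn[OF assms(1)] by blast
qed

text \<open>The clause on earlier stages is what ties all late positions of \<open>narrow\<close> to
  one common stage.\<close>

lemma stagewise_defined:
  assumes "\<forall>n. \<exists>l. g p l n \<noteq> 0"
  shows "\<exists>q. stagewise g p = Some q \<and> (\<forall>n. \<exists>l. g p l n = Suc (q n) \<and> (\<forall>l'<l. g p l' n = 0))"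
proof -
  define q where "q n = g p (LEAST l. g p l n \<noteq> 0) n - 1" for n
  have "\<exists>l. g p l n = Suc (q n) \<and> (\<forall>l'<l. g p l' n = 0)" for n
  proof (intro exI conjI allI impI)
    have "g p (LEAST l. g p l n \<noteq> 0) n \<noteq> 0" by (rule LeastI_ex) (use assms in blast)
    then show "g p (LEAST l. g p l n \<noteq> 0) n = Suc (q n)" by (simp add: q_def)
    show "g p l' n = 0" if "l' < (LEAST l. g p l n \<noteq> 0)" for l'
      using not_less_Least[OF that] by simp
  qed
  moreover have "stagewise g p = Some q" unfolding stagewise_def q_def using assms by (rule if_P)
  ultimately show ?thesis by blast
qed

lemma delta_unit_eq_Some:
  "delta_unit p = Some x \<longleftrightarrow> x \<in> {0..1} \<and> (\<forall>n. \<bar>nu_Q (p n) - x\<bar> \<le> (1/2) ^ n)"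
proof -
  let ?P = "\<lambda>x. x \<in> {0..1} \<and> (\<forall>n. \<bar>nu_Q (p n) - x\<bar> \<le> (1/2) ^ n)"
  have uniq: "x = y" if "?P x" "?P y" for x y
  proof (rule ccontr)
    assume "x \<noteq> y"
    then obtain n where "(1/2) ^ n < \<bar>x - y\<bar> / 2"
      using real_arch_pow_inv[of "\<bar>x - y\<bar> / 2" "1/2"] by auto
    moreover have "\<bar>nu_Q (p n) - x\<bar> \<le> (1/2) ^ n" "\<bar>nu_Q (p n) - y\<bar> \<le> (1/2) ^ n"
      using that by auto
    ultimately show False by (simp add: abs_if split: if_splits)
  qed
  show ?thesis
  proof (cases "\<exists>x. ?P x")
    case True
    then have "\<exists>!x. ?P x" using uniq by blast
    then have "?P (THE x. ?P x)" by (rule theI')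
    moreover have "delta_unit p = Some (THE x. ?P x)"
      unfolding delta_unit_def using True by (rule if_P)
    ultimately show ?thesis using uniq by (metis (no_types, lifting) option.inject)
  qed (auto simp: delta_unit_def)
qed

section \<open>The two functionals of the reduction\<close>

text \<open>\<open>2 * a\<close> is the integer code of the natural number \<open>a\<close>, and
  \<open>nu_Q\<close> divides by the successor of the second component.\<close>

definition rat_code :: "nat \<Rightarrow> nat \<Rightarrow> nat" where
  "rat_code a d = prod_encode (2 * a, d - 1)"

lemma nu_Q_rat_code: "0 < d \<Longrightarrow> nu_Q (rat_code a d) = real a / real d"
  by (simp add: nu_Q_def rat_code_def int_decode_def sum_decode_def)

text \<open>Truncated subtraction is harmless here: it replaces a negative endpoint by \<open>0\<close>, and the open
  interval from \<open>-1\<close> to \<open>0\<close> removes nothing from the unit interval.\<close>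

definition left_gap :: "nat \<Rightarrow> nat \<Rightarrow> nat \<Rightarrow> nat" where
  "left_gap m t r = prod_encode (prod_encode (1, 0), rat_code (m * r - t) (t * r))"

definition right_gap :: "nat \<Rightarrow> nat \<Rightarrow> nat \<Rightarrow> nat" where
  "right_gap m t r = prod_encode (rat_code (m * r + t) (t * r), rat_code 2 1)"

lemma rat_interval_gap:
  assumes "0 < t" "0 < r"
  shows "rat_interval (left_gap m t r) = {-1 <..< max 0 (real m / real t - 1 / real r)}"
    and "rat_interval (right_gap m t r) = {real m / real t + 1 / real r <..< 2}"
proof -
  have "nu_Q (prod_encode (1, 0)) = -1"
    by (simp add: nu_Q_def int_decode_def sum_decode_def)
  moreover have "real (m * r - t) / real (t * r) = max 0 (real m / real t - 1 / real r)"
  proof (cases "t \<le> m * r")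
    case True
    then have "real t \<le> real m * real r" by (metis of_nat_le_iff of_nat_mult)
    then have "0 \<le> real m / real t - 1 / real r" using assms by (simp add: field_simps)
    then show ?thesis using assms True by (simp add: of_nat_diff field_simps)
  next
    case False
    then have "real m * real r < real t" by (metis not_le of_nat_less_iff of_nat_mult)
    then have "real m / real t - 1 / real r \<le> 0" using assms by (simp add: field_simps)
    then show ?thesis using False by simp
  qed
  ultimately show "rat_interval (left_gap m t r) = {-1 <..< max 0 (real m / real t - 1 / real r)}"
    using assms by (simp add: rat_interval_def left_gap_def nu_Q_rat_code)
  have "real (m * r + t) / real (t * r) = real m / real t + 1 / real r"
    using assms by (simp add: field_simps)
  then show "rat_interval (right_gap m t r) = {real m / real t + 1 / real r <..< 2}"
    using assms by (simp add: rat_interval_def right_gap_def nu_Q_rat_code)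
qed

text \<open>From the first dirty stage \<open>k\<close> on, all output positions wait for the same stage \<^term>\<open>t\<close>, so that
  exactly two intervals are removed; a position \<^term>\<open>n\<close> answered earlier holds \<open>0\<close>, which is a code of
  the empty interval.\<close>

definition narrow :: "baire \<Rightarrow> nat \<Rightarrow> nat \<Rightarrow> nat" where
  "narrow p t n =
     (if dirty p (first_dirty p t)
      then if locates p t (first_dirty p t + 4) (location p t (first_dirty p t + 4))
        then Suc (if even n
          then left_gap (location p t (first_dirty p t + 4)) t (2 ^ (first_dirty p t + 2))
          else right_gap (location p t (first_dirty p t + 4)) t (2 ^ (first_dirty p t + 2)))
        else 0
      else if n < t then 1 else 0)"

text \<open>Position \<open>n\<close> asks for precision \<open>Suc n\<close> in both branches: a
  located point errs by up to 2 / 2^(n+1), and a copied digit must leave half of 2^-n for the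
  distance between the given point and the point of a singleton.\<close>

definition answer :: "baire \<Rightarrow> baire \<Rightarrow> nat \<Rightarrow> nat \<Rightarrow> nat" where
  "answer p s t n =
     (if dirty p (first_dirty p t)
      then if locates p t (Suc n) (location p t (Suc n))
        then Suc (rat_code (location p t (Suc n)) t) else 0
      else if Suc n < t then Suc (s (Suc n)) else 0)"

text \<open>A prefix of length \<^term>\<open>l\<close> of a pair contains prefixes of length \<^term>\<open>l div 2\<close> of its components.\<close>

definition answer_pair :: "baire \<Rightarrow> nat \<Rightarrow> nat \<Rightarrow> nat" where
  "answer_pair r l n = answer (\<lambda>j. r (2 * j)) (\<lambda>j. r (2 * j + 1)) (l div 2) n"

lemma rec_fn_rat_code:
  assumes "rec_fn k a" "rec_fn k b" shows "rec_fn k (\<lambda>xs. rat_code (a xs) (b xs))"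
  unfolding rat_code_def by (intro rec_fn_intros rec_fn_prod_encode assms)

lemma computable_narrow: "computable_partial (stagewise narrow)"
proof (rule computable_partial_stagewise)
  show "rec_fn (Suc (Suc 0)) (\<lambda>xs. narrow (\<lambda>j. code_nth (hd xs) (1 * j)) (code_length (hd xs)) (hd (tl xs)))"
    unfolding narrow_def left_gap_def right_gap_def
    by (intro rec_fn_intros rec_fn_rat_code rec_fn_prod_encode rec_fn_location rec_fn_first_dirty
        rec_test_dirty rec_test_locates rec_fn_code_length rec_test_even)
  fix p l n
  let ?q = "\<lambda>j. code_nth (prefix_code p l) (1 * j)"
  have eq: "?q j = p j" if "j < l" for j using that by (simp add: code_nth_prefix_code)
  show "narrow ?q (code_length (prefix_code p l)) n = narrow p l n"
    using prefix_cong[of l ?q p, OF eq] bmin_le[of "dirty p" l]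
    unfolding narrow_def code_length_prefix_code first_dirty_def by simp
qed

lemma rec_fn_div2:
  assumes "rec_fn k a" shows "rec_fn k (\<lambda>xs. a xs div 2)"
proof (rule rec_fn_comp1[OF _ assms])
  have "l div 2 = bmin (\<lambda>t. l < 2 * t + 2) l" for l :: nat
    by (rule bmin_eqI[symmetric]) auto
  moreover have "rec_fn (Suc 0) (\<lambda>xs. bmin (\<lambda>t. hd xs < 2 * t + 2) (hd xs))"
    by (intro rec_fn_intros)
  ultimately show "rec_fn (Suc 0) (\<lambda>xs. hd xs div 2)" by simp
qed

lemma computable_answer_pair: "computable_partial (stagewise answer_pair)"
proof (rule computable_partial_stagewise)
  show "rec_fn (Suc (Suc 0)) (\<lambda>xs. answer (\<lambda>j. code_nth (hd xs) (2 * j))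
      (\<lambda>j. code_nth (hd xs) (2 * j + 1)) (code_length (hd xs) div 2) (hd (tl xs)))"
    unfolding answer_def
    by (intro rec_fn_intros rec_fn_rat_code rec_fn_location rec_fn_first_dirty rec_fn_code_nth
        rec_test_dirty rec_test_locates rec_fn_code_length rec_fn_div2)
  fix r l n
  let ?q = "\<lambda>j. code_nth (prefix_code r l) (2 * j)"
  have eq: "?q j = r (2 * j)" if "j < l div 2" for j
    using that by (intro code_nth_prefix_code) auto
  show "answer ?q (\<lambda>j. code_nth (prefix_code r l) (2 * j + 1)) (code_length (prefix_code r l) div 2) n
      = answer_pair r l n"
    using prefix_cong[of "l div 2" ?q "\<lambda>j. r (2 * j)", OF eq]
      bmin_le[of "dirty (\<lambda>j. r (2 * j))" "l div 2"]
    unfolding answer_def answer_pair_def code_length_prefix_code first_dirty_def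
    by (auto simp: code_nth_prefix_code)
qed

lemma location_near:
  assumes "locates p t n (location p t n)" "{0..1} - (\<Union>n. rat_interval (p n)) = {x}"
  shows "\<bar>real (location p t n) / real t - x\<bar> \<le> 2 / 2 ^ n"
  using locates_imp_near[OF assms(1), of x] assms(2) by blast

lemma location_eventually:
  assumes "{0..1} - (\<Union>n. rat_interval (p n)) = {x}"
  shows "\<exists>t\<ge>k. locates p t n (location p t n)"
  using locates_eventually[OF assms, of n] locates_location by (metis max.cobounded1 max.cobounded2)

text \<open>With h = 2^-(k+2), locating at precision k+4 gives a centre within h/2 of
  \<open>x\<close>. The interval of radius h about it, cut to [0,1], is therefore nondegenerate, and
  its points are within 2h = 2^-(k+1) of \<open>x\<close>.\<close>

lemma narrow_singleton:
  assumes x: "{0..1} - (\<Union>n. rat_interval (p n)) = {x}"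
    and k: "dirty p k" "\<And>j. j < k \<Longrightarrow> \<not> dirty p j"
  obtains q a b where "stagewise narrow p = Some q" "delta_neg q = Some {a..b}"
    "0 \<le> a" "a < b" "b \<le> 1" "\<And>y. y \<in> {a..b} \<Longrightarrow> \<bar>y - x\<bar> \<le> (1/2) ^ (k + 1)"
proof -
  define loc where "loc t = (k \<le> t \<and> locates p t (k + 4) (location p t (k + 4)))" for t
  define T where "T = (LEAST t. loc t)"
  have T: "loc T" "\<And>t. t < T \<Longrightarrow> \<not> loc t"
  proof -
    have "\<exists>t. loc t" unfolding loc_def by (rule location_eventually[OF x])
    then show "loc T" unfolding T_def by (rule LeastI_ex)
    show "\<not> loc t" if "t < T" for t using that unfolding T_def by (rule not_less_Least)
  qed
  have kT: "k \<le> T" using T(1) by (simp add: loc_def)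
  define m where "m = location p T (k + 4)"
  define r :: nat where "r = 2 ^ (k + 2)"
  have narrow: "narrow p t n = (if k \<le> t then if loc t then Suc (if even n
      then left_gap (location p t (k + 4)) t (2 ^ (k + 2))
      else right_gap (location p t (k + 4)) t (2 ^ (k + 2))) else 0
      else if n < t then 1 else 0)" for t n
    using first_dirty_eq[OF k, of t] unfolding narrow_def loc_def by auto
  have nz: "narrow p T n = Suc (if even n then left_gap m T r else right_gap m T r)" for n
    using T(1) kT by (simp add: narrow m_def r_def)
  then have "\<forall>n. \<exists>t. narrow p t n \<noteq> 0" by (metis Zero_not_Suc)
  then obtain q where q: "stagewise narrow p = Some q"
    and qn: "\<And>n. \<exists>t. narrow p t n = Suc (q n) \<and> (\<forall>t'<t. narrow p t' n = 0)"
    using stagewise_defined[of narrow p] by blast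
  \<comment> \<open>A position is decided either before stage \<open>k\<close>, with value
    \<open>0\<close> and then \<open>n < k\<close>, or at the first locating stage \<open>T\<close>,
    which is the same for all positions.\<close>
  have val: "q n = (if even n then left_gap m T r else right_gap m T r) \<or> n < k \<and> q n = 0" for n
  proof -
    obtain t where t: "narrow p t n = Suc (q n)" "\<And>t'. t' < t \<Longrightarrow> narrow p t' n = 0"
      using qn by blast
    show ?thesis
    proof (cases "k \<le> t")
      case True
      then have "loc t" using t(1) by (auto simp: narrow split: if_splits)
      then have "T \<le> t" using T(2) by (meson not_le)
      moreover have "\<not> T < t" using t(2)[of T] nz[of n] by auto
      ultimately show ?thesis using t(1) nz[of n] by simp
    qed (use t(1) in \<open>auto simp: narrow split: if_splits\<close>)
  qed
  \<comment> \<open>These positions have both parities and are not below \<open>k\<close>, so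
    neither gap is lost to an early \<open>0\<close>.\<close>
  have qk: "q (2 * k) = left_gap m T r" "q (2 * k + 1) = right_gap m T r"
    using val[of "2 * k"] val[of "2 * k + 1"] by auto
  have zero: "rat_interval 0 = {}"
    by (simp add: rat_interval_def prod_decode_def prod_decode_aux.simps)
  have "(\<Union>n. rat_interval (q n)) = rat_interval (left_gap m T r) \<union> rat_interval (right_gap m T r)"
    (is "?L = ?R")
  proof
    show "?L \<subseteq> ?R"
    proof (rule UN_least)
      fix n show "rat_interval (q n) \<subseteq> ?R" using val[of n] zero by (auto split: if_splits)
    qed
    show "?R \<subseteq> ?L" unfolding qk[symmetric] by blast
  qed
  moreover have T0: "0 < T" using T(1) by (auto simp: loc_def locates_def)
  moreover have r0: "0 < r" by (simp add: r_def)
  ultimately have U: "(\<Union>n. rat_interval (q n)) =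
      {-1 <..< max 0 (real m / real T - 1 / real r)} \<union> {real m / real T + 1 / real r <..< 2}"
    by (simp only: rat_interval_gap)
  define a where "a = max 0 (real m / real T - 1 / real r)"
  define b where "b = min 1 (real m / real T + 1 / real r)"
  define h where "h = 1 / real r"
  have h: "0 < h" "h = (1/2) ^ (k + 2)" using r0 by (simp_all add: h_def r_def power_one_over)
  have "\<bar>real m / real T - x\<bar> \<le> 2 / 2 ^ (k + 4)"
    using location_near[OF _ x] T(1) unfolding m_def loc_def by blast
  also have "\<dots> = h / 2" by (simp add: h power_one_over power_add)
  finally have near: "\<bar>real m / real T - x\<bar> \<le> h / 2" .
  have x01: "x \<in> {0..1}" using x by blast
  have "delta_neg q = Some {a..b}"
    unfolding delta_neg_def U a_def b_def by auto
  moreover have "0 \<le> a" "b \<le> 1" by (simp_all add: a_def b_def)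
  moreover have "real m / real T - h < x" "x < real m / real T + h"
    using near h(1) by linarith+
  then have "a < b"
    using x01 h(1) unfolding a_def b_def h_def[symmetric] by auto
  moreover have "\<bar>y - x\<bar> \<le> (1/2) ^ (k + 1)" if "y \<in> {a..b}" for y
  proof -
    have "\<bar>y - real m / real T\<bar> \<le> h"
      using that unfolding a_def b_def h_def[symmetric] by auto
    then have "\<bar>y - x\<bar> \<le> 2 * h" using near h(1) by linarith
    also have "\<dots> = (1/2) ^ (k + 1)" by (simp add: h)
    finally show ?thesis .
  qed
  ultimately show ?thesis using q that by blast
qed

lemma narrow_unit:
  assumes "{0..1} - (\<Union>n. rat_interval (p n)) = {0..1::real}"
  obtains q where "stagewise narrow p = Some q" "delta_neg q = Some {0..1}"
proof -
  have clean: "\<not> dirty p t" for t using assms dirty_imp_ne_unit by blast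
  then have n: "narrow p t n = (if n < t then 1 else 0)" for t n by (simp add: narrow_def)
  then have "\<forall>n. \<exists>t. narrow p t n \<noteq> 0" by (metis lessI one_neq_zero)
  then obtain q where q: "stagewise narrow p = Some q" "\<And>n. \<exists>t. narrow p t n = Suc (q n)"
    using stagewise_defined[of narrow p] by blast
  have "q n = 0" for n using q(2)[of n] by (auto simp: n split: if_splits)
  then have "delta_neg q = Some {0..1}"
    by (simp add: delta_neg_def rat_interval_def prod_decode_def prod_decode_aux.simps)
  with q(1) show ?thesis by (rule that)
qed

text \<open>Unlike for \<open>narrow\<close>, positions may be decided at different stages: each
  value only has to approximate \<open>x\<close> to its own precision.\<close>

lemma answer_singleton:
  assumes x: "{0..1} - (\<Union>n. rat_interval (p n)) = {x}"
    and k: "dirty p k" "\<And>j. j < k \<Longrightarrow> \<not> dirty p j"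
    and y: "delta_unit s = Some y" "\<bar>y - x\<bar> \<le> (1/2) ^ (k + 1)"
  obtains q where "stagewise answer_pair (bpair p s) = Some q" "delta_unit q = Some x"
proof -
  let ?r = "bpair p s"
  have r: "(\<lambda>j. ?r (2 * j)) = p" "(\<lambda>j. ?r (2 * j + 1)) = s"
    by (simp_all add: bpair_def fun_eq_iff)
  have answer: "answer_pair ?r l n = (if k \<le> l div 2
      then if locates p (l div 2) (Suc n) (location p (l div 2) (Suc n))
        then Suc (rat_code (location p (l div 2) (Suc n)) (l div 2)) else 0
      else if Suc n < l div 2 then Suc (s (Suc n)) else 0)" for l n
    using first_dirty_eq[OF k, of "l div 2"] unfolding answer_pair_def r answer_def by auto
  have "\<forall>n. \<exists>l. answer_pair ?r l n \<noteq> 0"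
  proof
    fix n
    obtain t where t: "k \<le> t" "locates p t (Suc n) (location p t (Suc n))"
      using location_eventually[OF x] by blast
    then show "\<exists>l. answer_pair ?r l n \<noteq> 0" by (intro exI[of _ "2 * t"]) (simp add: answer)
  qed
  then obtain q where q: "stagewise answer_pair ?r = Some q"
    "\<And>n. \<exists>l. answer_pair ?r l n = Suc (q n)"
    using stagewise_defined[of answer_pair ?r] by blast
  have "\<bar>nu_Q (q n) - x\<bar> \<le> (1/2) ^ n" for n
  proof -
    obtain l where "answer_pair ?r l n = Suc (q n)" using q(2) by blast
    then consider
      (loc) "locates p (l div 2) (Suc n) (location p (l div 2) (Suc n))"
        "q n = rat_code (location p (l div 2) (Suc n)) (l div 2)"
      | (copy) "Suc n < k" "q n = s (Suc n)"
      by (auto simp: answer split: if_splits)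
    then show ?thesis
    proof cases
      case loc
      then have "0 < l div 2" by (auto simp: locates_def)
      then show ?thesis using location_near[OF loc(1) x] loc(2)
        by (simp add: nu_Q_rat_code power_one_over)
    next
      case copy
      have "\<bar>nu_Q (q n) - y\<bar> \<le> (1/2) ^ Suc n"
        using y(1) unfolding delta_unit_eq_Some copy(2) by blast
      moreover have "(1/2::real) ^ (k + 1) \<le> (1/2) ^ Suc n"
        using copy(1) by (intro power_decreasing) auto
      moreover have "(1/2::real) ^ Suc n + (1/2) ^ Suc n = (1/2) ^ n" by simp
      ultimately show ?thesis using y(2) by linarith
    qed
  qed
  then have "delta_unit q = Some x" using x unfolding delta_unit_eq_Some by blast
  with q(1) show ?thesis by (rule that)
qed

lemma answer_unit:
  assumes "{0..1} - (\<Union>n. rat_interval (p n)) = {0..1::real}" "delta_unit s = Some y"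
  obtains q where "stagewise answer_pair (bpair p s) = Some q" "delta_unit q = Some y"
proof -
  let ?r = "bpair p s"
  have r: "(\<lambda>j. ?r (2 * j)) = p" "(\<lambda>j. ?r (2 * j + 1)) = s"
    by (simp_all add: bpair_def fun_eq_iff)
  have clean: "\<not> dirty p t" for t using assms(1) dirty_imp_ne_unit by blast
  then have answer: "answer_pair ?r l n = (if Suc n < l div 2 then Suc (s (Suc n)) else 0)" for l n
    unfolding answer_pair_def r answer_def by simp
  have "answer_pair ?r (2 * Suc (Suc n)) n \<noteq> 0" for n by (simp only: answer) simp
  then have "\<forall>n. \<exists>l. answer_pair ?r l n \<noteq> 0" by blast
  then obtain q where q: "stagewise answer_pair ?r = Some q"
    "\<And>n. \<exists>l. answer_pair ?r l n = Suc (q n)"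
    using stagewise_defined[of answer_pair ?r] by blast
  have qs: "q n = s (Suc n)" for n using q(2)[of n] by (auto simp: answer split: if_splits)
  have "\<bar>nu_Q (q n) - y\<bar> \<le> (1/2) ^ n" for n
  proof -
    have "\<bar>nu_Q (q n) - y\<bar> \<le> (1/2) ^ Suc n"
      using assms(2) unfolding delta_unit_eq_Some qs by blast
    also have "\<dots> \<le> (1/2) ^ n" by simp
    finally show ?thesis .
  qed
  then have "delta_unit q = Some y" using assms(2) unfolding delta_unit_eq_Some by blast
  with q(1) show ?thesis by (rule that)
qed

lemma AUC_le_PCC: "weihrauch_le delta_neg delta_unit AUC_unit delta_neg delta_unit PCC_unit"
  unfolding weihrauch_le_def
proof (intro exI conjI allI impI)
  show "computable_partial (stagewise answer_pair)" "computable_partial (stagewise narrow)"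
    by (rule computable_answer_pair computable_narrow)+
  fix G assume G: "realizes delta_neg delta_unit PCC_unit G"
  have G_interval: "\<exists>s y. G q = Some s \<and> delta_unit s = Some y \<and> y \<in> {a..b}"
    if "delta_neg q = Some {a..b}" "0 \<le> a" "a < b" "b \<le> 1" for q a b
  proof -
    have P: "PCC_unit {a..b} = {a..b}" using that unfolding PCC_unit_def by auto
    then have "PCC_unit {a..b} \<noteq> {}" using that by simp
    with G that(1) have "\<exists>s y. G q = Some s \<and> delta_unit s = Some y \<and> y \<in> PCC_unit {a..b}"
      unfolding realizes_def by blast
    then show ?thesis unfolding P .
  qed
  show "realizes delta_neg delta_unit AUC_unit
      (\<lambda>p. Option.bind (stagewise narrow p) (\<lambda>r. Option.bind (G r) (\<lambda>s. stagewise answer_pair (bpair p s))))"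
    unfolding realizes_def
  proof (intro allI impI)
    fix p A assume "delta_neg p = Some A \<and> AUC_unit A \<noteq> {}"
    then have A: "{0..1} - (\<Union>n. rat_interval (p n)) = A" and dom: "AUC_unit A \<noteq> {}"
      by (auto simp: delta_neg_def)
    from dom consider "A = {0..1}" | x where "A = {x}"
      unfolding AUC_unit_def by (auto split: if_splits)
    then show "\<exists>q y. Option.bind (stagewise narrow p)
          (\<lambda>r. Option.bind (G r) (\<lambda>s. stagewise answer_pair (bpair p s))) = Some q \<and>
        delta_unit q = Some y \<and> y \<in> AUC_unit A"
    proof cases
      case 1
      have U: "{0..1} - (\<Union>n. rat_interval (p n)) = {0..1}" using A 1 by simp
      obtain r where r: "stagewise narrow p = Some r" "delta_neg r = Some {0..1}"
        using narrow_unit[OF U] by blast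
      obtain s y where s: "G r = Some s" "delta_unit s = Some y" "y \<in> {0..1}"
        using G_interval[OF r(2)] by auto
      obtain q where "stagewise answer_pair (bpair p s) = Some q" "delta_unit q = Some y"
        using answer_unit[OF U s(2)] by blast
      with r(1) s 1 show ?thesis by (auto simp: AUC_unit_def)
    next
      case 2
      then have x: "{0..1} - (\<Union>n. rat_interval (p n)) = {x}" using A by simp
      \<comment> \<open>This \<open>k\<close> depends on \<open>p\<close> alone, so the same number
        governs \<open>narrow\<close> and \<open>answer_pair\<close>, whose prefixes have unrelated
        lengths.\<close>
      define k where "k = (LEAST k. dirty p k)"
      have k: "dirty p k" "\<And>j. j < k \<Longrightarrow> \<not> dirty p j"
      proof -
        show "dirty p k" unfolding k_def using dirty_if_singleton[OF x] by (rule LeastI_ex)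
        show "\<not> dirty p j" if "j < k" for j using that unfolding k_def by (rule not_less_Least)
      qed
      obtain r a b where r: "stagewise narrow p = Some r" "delta_neg r = Some {a..b}"
        "0 \<le> a" "a < b" "b \<le> 1" "\<And>y. y \<in> {a..b} \<Longrightarrow> \<bar>y - x\<bar> \<le> (1/2) ^ (k + 1)"
        using narrow_singleton[OF x k] by blast
      obtain s y where s: "G r = Some s" "delta_unit s = Some y" "y \<in> {a..b}"
        using G_interval[OF r(2-5)] by blast
      obtain q where "stagewise answer_pair (bpair p s) = Some q" "delta_unit q = Some x"
        using answer_singleton[OF x k s(2) r(6)[OF s(3)]] by blast
      with r(1) s(1) dom 2 show ?thesis by (auto simp: AUC_unit_def split: if_splits)
    qed
  qed
qed

section \<open>Continuity and the failure of the converse reduction\<close>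

definition agree :: "nat \<Rightarrow> baire \<Rightarrow> baire \<Rightarrow> bool" where
  "agree k p q \<longleftrightarrow> (\<forall>j<k. p j = q j)"

text \<open>Points where \<open>F\<close> is undefined impose no condition, be it as
  \<open>p\<close> or as \<open>p'\<close>.\<close>

definition continuous_within :: "baire set \<Rightarrow> (baire \<Rightarrow> baire option) \<Rightarrow> baire \<Rightarrow> bool" where
  "continuous_within D F p \<longleftrightarrow> (\<forall>q N. F p = Some q \<longrightarrow>
     (\<exists>k. \<forall>p'\<in>D. \<forall>q'. agree k p p' \<longrightarrow> F p' = Some q' \<longrightarrow> agree N q q'))"

lemma agree_mono: "agree k p q \<Longrightarrow> l \<le> k \<Longrightarrow> agree l p q"
  by (auto simp: agree_def)

lemma continuous_withinI:
  assumes "\<And>q n. F p = Some q \<Longrightarrow>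
    \<exists>k. \<forall>p'\<in>D. \<forall>q'. agree k p p' \<longrightarrow> F p' = Some q' \<longrightarrow> q n = q' n"
  shows "continuous_within D F p"
  unfolding continuous_within_def
proof (intro allI impI)
  fix q N assume q: "F p = Some q"
  show "\<exists>k. \<forall>p'\<in>D. \<forall>q'. agree k p p' \<longrightarrow> F p' = Some q' \<longrightarrow> agree N q q'"
  proof (induction N)
    case (Suc N)
    then obtain k where k: "\<forall>p'\<in>D. \<forall>q'. agree k p p' \<longrightarrow> F p' = Some q' \<longrightarrow> agree N q q'"
      by blast
    obtain l where l: "\<forall>p'\<in>D. \<forall>q'. agree l p p' \<longrightarrow> F p' = Some q' \<longrightarrow> q N = q' N"
      using assms[OF q] by blast
    have "agree (Suc N) q q'" if "p' \<in> D" "agree (max k l) p p'" "F p' = Some q'" for p' q'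
    proof -
      have "agree k p p'" "agree l p p'" using that(2) by (auto elim: agree_mono)
      with k l that show ?thesis unfolding agree_def by (auto simp: less_Suc_eq)
    qed
    then show ?case by blast
  qed (simp add: agree_def)
qed

text \<open>Output position \<open>n\<close> is settled by the prefix of the least successful length
  \<open>k\<close>; any input sharing that prefix has the same least length and the same
  value.\<close>

lemma continuous_within_computable:
  assumes "computable_partial F" shows "continuous_within UNIV F p"
proof (rule continuous_withinI)
  fix q n assume q: "F p = Some q"
  obtain h where h: "F = type2_fun h"
    using assms by (auto simp: computable_partial_def)
  let ?P = "\<lambda>p k. h (prod_encode (prefix_code p k, n)) \<noteq> 0"
  define k where "k = (LEAST k. ?P p k)"
  have def: "\<forall>n. \<exists>k. h (prod_encode (prefix_code p k, n)) \<noteq> 0"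
    using q unfolding h type2_fun_def by (auto split: if_splits)
  have k: "?P p k" unfolding k_def by (rule LeastI_ex) (use def in blast)
  have "q n = q' n" if "agree k p p'" "F p' = Some q'" for p' q'
  proof -
    have pre: "prefix_code p' i = prefix_code p i" if "i \<le> k" for i
      using \<open>agree k p p'\<close> that by (auto simp: prefix_code_def agree_def intro!: arg_cong[of _ _ list_encode])
    have "(LEAST k. ?P p' k) = k"
    proof (rule Least_equality)
      show "?P p' k" using k by (simp add: pre)
      show "k \<le> i" if "?P p' i" for i
        using that pre[of i] not_less_Least[of i "?P p"] unfolding k_def[symmetric]
        by (metis linorder_le_cases not_le)
    qed
    moreover have "q n = h (prod_encode (prefix_code p k, n)) - 1"
      using q unfolding h type2_fun_def k_def by (auto split: if_splits)
    moreover have "q' n = h (prod_encode (prefix_code p' (LEAST k. ?P p' k), n)) - 1"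
      using that(2) unfolding h type2_fun_def by (auto split: if_splits)
    ultimately show ?thesis by (simp add: pre)
  qed
  then show "\<exists>k. \<forall>p'\<in>UNIV. \<forall>q'. agree k p p' \<longrightarrow> F p' = Some q' \<longrightarrow> q n = q' n" by blast
qed

lemma continuous_within_bind:
  assumes K: "continuous_within D K p" and G: "\<And>r. K p = Some r \<Longrightarrow> continuous_within UNIV G r"
  shows "continuous_within D (\<lambda>p. Option.bind (K p) G) p"
  unfolding continuous_within_def
proof (intro allI impI)
  fix q N assume "Option.bind (K p) G = Some q"
  then obtain r where r: "K p = Some r" "G r = Some q" by (auto simp: bind_eq_Some_conv)
  then obtain l where l: "\<And>r' q'. agree l r r' \<Longrightarrow> G r' = Some q' \<Longrightarrow> agree N q q'"
    using G[OF r(1)] unfolding continuous_within_def by blast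
  obtain k where "\<And>p' r'. p' \<in> D \<Longrightarrow> agree k p p' \<Longrightarrow> K p' = Some r' \<Longrightarrow> agree l r r'"
    using K r(1) unfolding continuous_within_def by blast
  with l show "\<exists>k. \<forall>p'\<in>D. \<forall>q'. agree k p p' \<longrightarrow> Option.bind (K p') G = Some q' \<longrightarrow> agree N q q'"
    by (metis bind_eq_Some_conv)
qed

lemma agree_bpair:
  assumes "agree k p p'" "agree k s s'" shows "agree k (bpair p s) (bpair p' s')"
  unfolding agree_def
proof (intro allI impI)
  fix j assume "j < k"
  moreover have "j div 2 \<le> j" by simp
  ultimately have "j div 2 < k" by linarith
  then show "bpair p s j = bpair p' s' j" using assms by (simp add: agree_def bpair_def)
qed

text \<open>\<open>H\<close> reads \<open>p\<close> besides \<open>s\<close>, so this is no instance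
  of \<open>continuous_within_bind\<close>; the moduli for the two components are combined by
  \<open>max\<close>.\<close>

lemma continuous_within_bind_bpair:
  assumes S: "continuous_within D S p" and H: "\<And>r. continuous_within UNIV H r"
  shows "continuous_within D (\<lambda>p. Option.bind (S p) (\<lambda>s. H (bpair p s))) p"
  unfolding continuous_within_def
proof (intro allI impI)
  fix q N assume "Option.bind (S p) (\<lambda>s. H (bpair p s)) = Some q"
  then obtain s where s: "S p = Some s" "H (bpair p s) = Some q" by (auto simp: bind_eq_Some_conv)
  then obtain l where l: "\<And>r' q'. agree l (bpair p s) r' \<Longrightarrow> H r' = Some q' \<Longrightarrow> agree N q q'"
    using H[of "bpair p s"] unfolding continuous_within_def by blast
  obtain k where k: "\<And>p' s'. p' \<in> D \<Longrightarrow> agree k p p' \<Longrightarrow> S p' = Some s' \<Longrightarrow> agree l s s'"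
    using S s(1) unfolding continuous_within_def by blast
  have "agree N q q'" if p': "p' \<in> D" "agree (max k l) p p'"
    and q': "Option.bind (S p') (\<lambda>s. H (bpair p' s)) = Some q'" for p' q'
  proof -
    obtain s' where s': "S p' = Some s'" "H (bpair p' s') = Some q'"
      using q' by (auto simp: bind_eq_Some_conv)
    have "agree k p p'" "agree l p p'" using p'(2) by (auto elim: agree_mono)
    then show ?thesis using l agree_bpair k p'(1) s' by blast
  qed
  then show "\<exists>k. \<forall>p'\<in>D. \<forall>q'. agree k p p' \<longrightarrow>
      Option.bind (S p') (\<lambda>s. H (bpair p' s)) = Some q' \<longrightarrow> agree N q q'" by blast
qed

section \<open>A realizer of AUC that is continuous off the names of the unit interval\<close>

definition singleton_stage :: "baire \<Rightarrow> nat \<Rightarrow> nat" where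
  "singleton_stage p n = (LEAST t. locates p t (Suc n) (location p t (Suc n)))"

definition singleton_name :: "baire \<Rightarrow> baire" where
  "singleton_name p n = rat_code (location p (singleton_stage p n) (Suc n)) (singleton_stage p n)"

lemma locates_singleton_stage:
  assumes "{0..1} - (\<Union>n. rat_interval (p n)) = {x}"
  shows "locates p (singleton_stage p n) (Suc n) (location p (singleton_stage p n) (Suc n))"
  unfolding singleton_stage_def
  by (rule LeastI_ex) (use location_eventually[OF assms] in blast)

lemma delta_unit_singleton_name:
  assumes x: "{0..1} - (\<Union>n. rat_interval (p n)) = {x}"
  shows "delta_unit (singleton_name p) = Some x"
  unfolding delta_unit_eq_Some
proof (intro conjI allI)
  show "x \<in> {0..1}" using x by blast
  fix n
  note loc = locates_singleton_stage[OF x, of n]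
  then have "0 < singleton_stage p n" by (auto simp: locates_def)
  then show "\<bar>nu_Q (singleton_name p n) - x\<bar> \<le> (1/2) ^ n"
    using location_near[OF loc x] by (simp add: singleton_name_def nu_Q_rat_code power_one_over)
qed

text \<open>The search for the stage reads only as many entries as the stage it ends at, so it runs
  identically on \<open>p'\<close>, whatever set \<open>p'\<close> names.\<close>

lemma singleton_name_cong:
  assumes x: "{0..1} - (\<Union>n. rat_interval (p n)) = {x}" and "agree (singleton_stage p n) p p'"
  shows "singleton_name p' n = singleton_name p n"
proof -
  have cong: "locates p' t = locates p t" "location p' t m = location p t m"
    if "t \<le> singleton_stage p n" for t m
    using prefix_cong(2,4)[of t p' p] assms(2) that by (auto simp: agree_def fun_eq_iff)
  have "singleton_stage p' n = singleton_stage p n"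
    unfolding singleton_stage_def[of p']
  proof (rule Least_equality)
    show "locates p' (singleton_stage p n) (Suc n) (location p' (singleton_stage p n) (Suc n))"
      using locates_singleton_stage[OF x] by (simp add: cong)
    fix t assume t: "locates p' t (Suc n) (location p' t (Suc n))"
    show "singleton_stage p n \<le> t"
    proof (rule ccontr)
      assume "\<not> singleton_stage p n \<le> t"
      with t have "t < singleton_stage p n" "locates p t (Suc n) (location p t (Suc n))"
        by (simp_all add: cong)
      then show False unfolding singleton_stage_def using not_less_Least by blast
    qed
  qed
  then show ?thesis by (simp add: singleton_name_def cong)
qed

text \<open>\<^const>\<open>None\<close> off the domain: if a reduction succeeds with this realizer, it queries only
  names of the unit interval or of singletons.\<close>

definition AUC_realizer :: "baire \<Rightarrow> baire option" where
  "AUC_realizer r = (if delta_neg r = Some {0..1} then Some (\<lambda>_. 0)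
     else if \<exists>x. delta_neg r = Some {x} then Some (singleton_name r) else None)"

lemma nu_Q_0: "nu_Q 0 = 0"
  by (simp add: nu_Q_def prod_decode_def prod_decode_aux.simps int_decode_def sum_decode_def)

lemma realizes_AUC_realizer: "realizes delta_neg delta_unit AUC_unit AUC_realizer"
  unfolding realizes_def
proof (intro allI impI)
  fix r A assume A: "delta_neg r = Some A \<and> AUC_unit A \<noteq> {}"
  then have Aeq: "AUC_unit A = A" by (auto simp: AUC_unit_def split: if_splits)
  from A consider "A = {0..1}" | x where "A = {x}" "A \<noteq> {0..1}"
    unfolding AUC_unit_def by (auto split: if_splits)
  then show "\<exists>q y. AUC_realizer r = Some q \<and> delta_unit q = Some y \<and> y \<in> AUC_unit A"
  proof cases
    case 1
    have "delta_unit (\<lambda>_. 0) = Some 0" by (simp add: delta_unit_eq_Some nu_Q_0)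
    with 1 A show ?thesis unfolding Aeq by (auto simp: AUC_realizer_def)
  next
    case 2
    then have "delta_unit (singleton_name r) = Some x"
      using A by (intro delta_unit_singleton_name) (simp add: delta_neg_def)
    with 2 A show ?thesis unfolding Aeq by (auto simp: AUC_realizer_def)
  qed
qed

text \<open>Here \<open>r\<close> names a singleton or lies outside the domain, where the claim is
  vacuous. A dirty stage of a name of a singleton shows in a finite prefix, so no nearby
  \<open>r'\<close> names [0,1] and the constant branch cannot interfere.\<close>

lemma continuous_within_AUC_realizer:
  assumes "delta_neg r \<noteq> Some {0..1}"
  shows "continuous_within UNIV AUC_realizer r"
proof (rule continuous_withinI)
  fix q n assume "AUC_realizer r = Some q"
  then obtain x where q: "q = singleton_name r" and "delta_neg r = Some {x}"
    using assms by (auto simp: AUC_realizer_def split: if_splits)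
  then have x: "{0..1} - (\<Union>n. rat_interval (r n)) = {x}" by (simp add: delta_neg_def)
  obtain t where t: "dirty r t" using dirty_if_singleton[OF x] by blast
  have "q n = q' n" if "agree (max t (singleton_stage r n)) r r'" "AUC_realizer r' = Some q'" for r' q'
  proof -
    have ag: "agree t r r'" "agree (singleton_stage r n) r r'"
      using that(1) by (auto elim: agree_mono)
    have "dirty r' t" using prefix_cong(1)[of t r r' t] ag(1) t by (auto simp: agree_def)
    then have "delta_neg r' \<noteq> Some {0..1}"
      using dirty_imp_ne_unit by (auto simp: delta_neg_def)
    then have "q' = singleton_name r'"
      using that(2) by (auto simp: AUC_realizer_def split: if_splits)
    then show ?thesis using singleton_name_cong[OF x ag(2)] q by simp
  qed
  then show "\<exists>k. \<forall>r'\<in>UNIV. \<forall>q'. agree k r r' \<longrightarrow> AUC_realizer r' = Some q' \<longrightarrow> q n = q' n" by blast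
qed

section \<open>Discontinuity of every realizer of PCC\<close>

lemma nu_Q_surj: assumes "x \<in> \<rat>" obtains c where "nu_Q c = x"
proof -
  obtain i n where x: "x = real_of_int i / real n" "n \<noteq> 0"
    using assms unfolding Rats_eq_int_div_nat by blast
  show ?thesis
    by (rule that[of "prod_encode (int_encode i, n - 1)"]) (use x in \<open>simp add: nu_Q_def\<close>)
qed

lemma PCC_unit_nonempty_iff:
  "PCC_unit A \<noteq> {} \<longleftrightarrow> (\<exists>a b. 0 \<le> a \<and> a < b \<and> b \<le> 1 \<and> A = {a..b})"
  by (auto simp: PCC_unit_def)

lemma PCC_unit_eq: "PCC_unit A \<noteq> {} \<Longrightarrow> PCC_unit A = A"
  by (auto simp: PCC_unit_def split: if_splits)

definition PCC_names :: "baire set" where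
  "PCC_names = {p. \<exists>A. delta_neg p = Some A \<and> PCC_unit A \<noteq> {}}"

text \<open>The closed interval of radius \<open>e\<close> about \<open>v\<close> is shorter than
  [a,b], so it leaves room at the right or at the left end. Removing everything up to, or from, a
  rational in that room keeps a nondegenerate rest.\<close>

lemma shrink_avoiding:
  fixes a b v e :: real
  assumes "0 \<le> a" "b \<le> 1" "0 < e" "2 * e < b - a"
  obtains c a' b' where "a \<le> a'" "a' < b'" "b' \<le> b" "{a..b} - rat_interval c = {a'..b'}"
    "\<And>y. y \<in> {a'..b'} \<Longrightarrow> e < \<bar>v - y\<bar>"
proof (cases "v + e < b")
  case True
  then have "max a (v + e) < b" using assms by auto
  then obtain r where r: "r \<in> \<rat>" "max a (v + e) < r" "r < b"
    using Rats_dense_in_real by blast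
  obtain c where c: "nu_Q c = r" using nu_Q_surj[OF r(1)] .
  obtain d where d: "nu_Q d = -1" using nu_Q_surj[of "-1"] by auto
  show ?thesis
    by (rule that[of r b "prod_encode (d, c)"])
      (use r c d assms in \<open>auto simp: rat_interval_def\<close>)
next
  case False
  then have "a < min b (v - e)" using assms by auto
  then obtain r where r: "r \<in> \<rat>" "a < r" "r < min b (v - e)"
    using Rats_dense_in_real by blast
  obtain c where c: "nu_Q c = r" using nu_Q_surj[OF r(1)] .
  obtain d where d: "nu_Q d = 2" using nu_Q_surj[of 2] by auto
  show ?thesis
    by (rule that[of a r "prod_encode (c, d)"])
      (use r c d assms in \<open>auto simp: rat_interval_def\<close>)
qed

lemma PCC_realizer_discontinuous:
  assumes F: "realizes delta_neg delta_unit PCC_unit F" and p: "p \<in> PCC_names"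
  shows "\<not> continuous_within PCC_names F p"
proof
  assume cont: "continuous_within PCC_names F p"
  obtain a b where ab: "delta_neg p = Some {a..b}" "0 \<le> a" "a < b" "b \<le> 1"
    using p unfolding PCC_names_def PCC_unit_nonempty_iff by blast
  then obtain q where q: "F p = Some q"
    using F p unfolding realizes_def PCC_names_def by blast
  \<comment> \<open>Digit \<open>m\<close> confines the answer to an interval of length 2 * 2^-m,
    which is to be shorter than [a,b].\<close>
  obtain m where m: "(1/2) ^ m < (b - a) / 2"
    using real_arch_pow_inv[of "(b - a) / 2" "1/2"] ab by auto
  then have e: "0 < (1/2::real) ^ m" "2 * (1/2) ^ m < b - a" by simp_all
  obtain k where k: "\<And>p' q'. p' \<in> PCC_names \<Longrightarrow> agree k p p' \<Longrightarrow> F p' = Some q' \<Longrightarrow> agree (Suc m) q q'"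
    using cont q unfolding continuous_within_def by blast
  obtain c a' b' where c: "a \<le> a'" "a' < b'" "b' \<le> b" "{a..b} - rat_interval c = {a'..b'}"
    "\<And>y. y \<in> {a'..b'} \<Longrightarrow> (1/2) ^ m < \<bar>nu_Q (q m) - y\<bar>"
    by (rule shrink_avoiding[OF ab(2,4) e, of "nu_Q (q m)"]) (rule that, assumption+)
  \<comment> \<open>The new interval is inserted at position \<open>k\<close> rather than
    overwriting \<open>p k\<close>, so that nothing removed by \<open>p\<close> is restored.\<close>
  define p' where "p' i = (if i < k then p i else if i = k then c else p (i - 1))" for i
  have "(\<Union>n. rat_interval (p' n)) = (\<Union>n. rat_interval (p n)) \<union> rat_interval c"
  proof -
    have "range p' = range p \<union> {c}"
    proof (intro equalityI subsetI)
      fix z assume "z \<in> range p \<union> {c}"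
      then consider n where "z = p n" | "z = c" by blast
      then show "z \<in> range p'"
      proof cases
        case 1
        then have "z = p' (if n < k then n else Suc n)" by (simp add: p'_def)
        then show ?thesis by blast
      next
        case 2
        then have "z = p' k" by (simp add: p'_def)
        then show ?thesis by blast
      qed
    qed (auto simp: p'_def)
    then have "(\<Union>z\<in>range p'. rat_interval z) = (\<Union>z\<in>range p \<union> {c}. rat_interval z)" by simp
    then show ?thesis by (simp add: Un_commute)
  qed
  then have p': "delta_neg p' = Some {a'..b'}"
    using ab(1) c(4) unfolding delta_neg_def by auto
  moreover have ne: "PCC_unit {a'..b'} \<noteq> {}"
    unfolding PCC_unit_nonempty_iff using c ab by (intro exI[of _ a'] exI[of _ b']) auto
  ultimately obtain q' y where q': "F p' = Some q'" "delta_unit q' = Some y" "y \<in> {a'..b'}"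
    using F unfolding realizes_def by (metis PCC_unit_eq)
  have "p' \<in> PCC_names" using p' ne by (auto simp: PCC_names_def)
  moreover have "agree k p p'" by (simp add: agree_def p'_def)
  ultimately have "q' m = q m" using k q'(1) by (simp add: agree_def)
  then have "\<bar>nu_Q (q m) - y\<bar> \<le> (1/2) ^ m"
    using q'(2) unfolding delta_unit_eq_Some by metis
  with c(5)[OF q'(3)] show False by simp
qed

lemma not_PCC_le_AUC:
  "\<not> weihrauch_le delta_neg delta_unit PCC_unit delta_neg delta_unit AUC_unit"
proof
  assume "weihrauch_le delta_neg delta_unit PCC_unit delta_neg delta_unit AUC_unit"
  then obtain H K where HK: "computable_partial H" "computable_partial K"
    and "realizes delta_neg delta_unit PCC_unit
      (\<lambda>p. Option.bind (K p) (\<lambda>r. Option.bind (AUC_realizer r) (\<lambda>s. H (bpair p s))))"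
    unfolding weihrauch_le_def using realizes_AUC_realizer by blast
  moreover define S where "S p = Option.bind (K p) AUC_realizer" for p
  ultimately have F: "realizes delta_neg delta_unit PCC_unit
      (\<lambda>p. Option.bind (S p) (\<lambda>s. H (bpair p s)))"
    by simp
  have S_discont: "\<not> continuous_within PCC_names S p" if "p \<in> PCC_names" for p
    using PCC_realizer_discontinuous[OF F that] continuous_within_bind_bpair
      continuous_within_computable[OF HK(1)] by blast
  have K_unit: "delta_neg r = Some {0..1}" if "p \<in> PCC_names" "K p = Some r" for p r
  proof (rule ccontr)
    assume "delta_neg r \<noteq> Some {0..1}"
    \<comment> \<open>This also covers an \<open>r\<close> that names neither [0,1] nor a
      singleton.\<close>
    then have "continuous_within UNIV AUC_realizer r" by (rule continuous_within_AUC_realizer)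
    moreover have "continuous_within PCC_names K p"
      using continuous_within_computable[OF HK(2), of p] unfolding continuous_within_def by blast
    ultimately have "continuous_within PCC_names S p"
      using that(2) unfolding S_def by (intro continuous_within_bind) auto
    with S_discont that(1) show False by blast
  qed
  have S_const: "q = (\<lambda>_. 0)" if p: "p \<in> PCC_names" and q: "S p = Some q" for p q
  proof -
    obtain r where "K p = Some r" "AUC_realizer r = Some q"
      using q unfolding S_def bind_eq_Some_conv by blast
    then show ?thesis using K_unit[OF p] by (simp add: AUC_realizer_def)
  qed
  \<comment> \<open>Any element of \<open>PCC_names\<close> would do; the zero sequence enumerates
    only empty intervals.\<close>
  define p :: baire where "p = (\<lambda>_. 0)"
  have "delta_neg p = Some {0..1}"
    by (simp add: p_def delta_neg_def rat_interval_def prod_decode_def prod_decode_aux.simps)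
  then have p: "p \<in> PCC_names"
    unfolding PCC_names_def PCC_unit_nonempty_iff by (auto intro: exI[of _ 0] exI[of _ 1])
  have "continuous_within PCC_names S p"
  proof (rule continuous_withinI)
    fix q n assume "S p = Some q"
    from S_const[OF p this] have "q n = 0" by simp
    then have "q n = q' n" if "p' \<in> PCC_names" "S p' = Some q'" for p' q'
      by (simp add: S_const[OF that])
    then show "\<exists>k. \<forall>p'\<in>PCC_names. \<forall>q'. agree k p p' \<longrightarrow> S p' = Some q' \<longrightarrow> q n = q' n" by blast
  qed
  with S_discont[OF p] show False ..
qed


theorem theorem16p2:
  shows "weihrauch_less delta_neg delta_unit AUC_unit delta_neg delta_unit PCC_unit"
  unfolding weihrauch_less_def using AUC_le_PCC not_PCC_le_AUC ..

end
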